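(* Let $(M,g)$ be a pseudo-Riemannian manifold which is decomposable by a Lie group $\Sigma$, with associated pseudo-Riemannian submersion $\pi:(M,g)\to(I,\tilde\varepsilon\,ds^2)$ and associated function $h:I\to\mathbb{R}$. Let $\varepsilon'\in\{1,-1\}$ be such that $\tilde\varepsilon\varepsilon'=-1$. Let $f$ be a local solution to $$f''(s)=\big(\tilde\varepsilon+\varepsilon'(f'(s))^2\big)\big(1-f'(s)h(s)\big)$$ defined around $s_o\in I$, such that $(f'(s_o))^2<1$. Then $f$ can be globally extended to a solution $f:I\to\mathbb{R}$. In particular, the associated $\Sigma$-invariant translating soliton in $(M\times\mathbb{R},g+\varepsilon'dt^2)$ is graphical and can be globally defined on $M$, namely as $F:M\to M\times\mathbb{R}$, $F(x)=(x,f(\pi(x)))$.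
   Context: Decomposable: $\Sigma$ is a Lie group acting properly by isometries on $(M,g)$, all orbits have codimension one, the orbit space $M/\Sigma$ is identified with an open interval $I$, and the projection $\pi:M\to I$ is a pseudo-Riemannian submersion onto $(I,\tilde\varepsilon\,ds^2)$, where $\tilde\varepsilon=g(\nabla\pi,\nabla\pi)\in\{1,-1\}$ is constant. The fibers $\pi^{-1}(s)$ are the orbits of $\Sigma$, and each has constant mean curvature $h(s)$ with respect to the unit normal $-\nabla\pi$; this defines the associated smooth function $h:I\to\mathbb{R}$. Moreover, for one of the stabilizers $\Sigma_o$ there is a unit curve $\beta:I\to M$ orthogonal to all orbits such that $\phi:I\times(\Sigma/\Sigma_o)\to M$, $\phi(s,[\sigma])=\sigma\cdot\beta(s)$, is a (well-defined) diffeomorphism with $\pi\circ\phi(s,[\sigma])=s$. Mean curvature conventions: for a non-degenerate hypersurface with unit normal $\nu$, $\langle\nu,\nu\rangle=\varepsilon=\pm1$, the mean curvature vector $\vec H$ is the (unnormalized) trace of the second fundamental form with respect to the induced metric, and the mean curvature function $H$ with respect to $\nu$ is defined by $\vec H=\varepsilon H\nu$. With these conventions $\mathrm{div}(\nabla\pi)=h\circ\pi$. A non-degenerate hypersurface of $(M\times\mathbb{R},g+\varepsilon'dt^2)$ is a translating soliton if $\vec H=\partial_t^\perp$, the component of $\partial_t$ normal to the hypersurface. It is $\Sigma$-invariant if it is invariant under the action $\sigma\cdot(x,t)=(\sigma\cdot x,t)$, and graphical if it is the image of a map $x\mapsto(x,u(x))$. *)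

theory Defs
  imports "HOL-Analysis.Analysis" "HOL-Algebra.Group_Action"
begin

section \<open>Smooth manifolds\<close>

text \<open>To be used on open sets only: derivatives are two-sided at every point of the set.\<close>

primrec Ck_on :: "nat \<Rightarrow> 'a::real_normed_vector set \<Rightarrow> ('a \<Rightarrow> 'b::real_normed_vector) \<Rightarrow> bool" where
  "Ck_on 0 U f \<longleftrightarrow> continuous_on U f"
| "Ck_on (Suc k) U f \<longleftrightarrow>
     (\<forall>x\<in>U. f differentiable (at x)) \<and> (\<forall>v. Ck_on k U (\<lambda>x. frechet_derivative f (at x) v))"

definition smooth_on :: "'a::real_normed_vector set \<Rightarrow> ('a \<Rightarrow> 'b::real_normed_vector) \<Rightarrow> bool" where
  "smooth_on U f \<longleftrightarrow> (\<forall>k. Ck_on k U f)"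

text \<open>A topological space with an indexed family of charts \<open>chart M i\<close>, defined on
  \<open>cdom M i\<close> for \<open>i \<in> idx M\<close>. Indexing the charts lets tensor fields be given by their
  components in each chart of the atlas.\<close>

record ('p, 'i, 'v) manifold =
  mtop :: "'p topology"
  idx :: "'i set"
  cdom :: "'i \<Rightarrow> 'p set"
  chart :: "'i \<Rightarrow> 'p \<Rightarrow> 'v"

abbreviation pts :: "('p, 'i, 'v) manifold \<Rightarrow> 'p set" where
  "pts M \<equiv> topspace (mtop M)"

definition charts_at :: "('p, 'i, 'v) manifold \<Rightarrow> 'p \<Rightarrow> 'i set" where
  "charts_at M p = {i \<in> idx M. p \<in> cdom M i}"

definition crange :: "('p, 'i, 'v) manifold \<Rightarrow> 'i \<Rightarrow> 'v set" where
  "crange M i = chart M i ` cdom M i"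

definition param :: "('p, 'i, 'v) manifold \<Rightarrow> 'i \<Rightarrow> 'v \<Rightarrow> 'p" where
  "param M i = inv_into (cdom M i) (chart M i)"

text \<open>The model space ranges over finite-dimensional normed spaces rather than over
  \<^class>\<open>euclidean_space\<close>, whose instances have positive dimension: groups and homogeneous
  spaces of dimension 0 are not excluded.\<close>

definition smooth_manifold :: "('p, 'i, 'v::real_normed_vector) manifold \<Rightarrow> bool" where
  "smooth_manifold M \<longleftrightarrow>
     (\<exists>B::'v set. finite B \<and> span B = UNIV) \<and>
     Hausdorff_space (mtop M) \<and> second_countable (mtop M) \<and>
     (\<Union>i\<in>idx M. cdom M i) = pts M \<and>
     (\<forall>i\<in>idx M. openin (mtop M) (cdom M i) \<and> open (crange M i) \<and>
        homeomorphic_map (subtopology (mtop M) (cdom M i)) (top_of_set (crange M i)) (chart M i)) \<and>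
     (\<forall>i\<in>idx M. \<forall>j\<in>idx M.
        smooth_on (chart M i ` (cdom M i \<inter> cdom M j)) (chart M j \<circ> param M i))"

definition local_rep ::
  "('p, 'i, 'v) manifold \<Rightarrow> ('q, 'j, 'w) manifold \<Rightarrow> ('p \<Rightarrow> 'q) \<Rightarrow> 'i \<Rightarrow> 'j \<Rightarrow> 'v \<Rightarrow> 'w" where
  "local_rep M N f i j = chart N j \<circ> f \<circ> param M i"

definition smooth_map ::
  "('p, 'i, 'v::real_normed_vector) manifold \<Rightarrow> ('q, 'j, 'w::real_normed_vector) manifold \<Rightarrow>
   ('p \<Rightarrow> 'q) \<Rightarrow> bool" where
  "smooth_map M N f \<longleftrightarrow>
     continuous_map (mtop M) (mtop N) f \<and>
     (\<forall>i\<in>idx M. \<forall>j\<in>idx N.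
        smooth_on (chart M i ` {x \<in> cdom M i. f x \<in> cdom N j}) (local_rep M N f i j))"

definition differential ::
  "('p, 'i, 'v::real_normed_vector) manifold \<Rightarrow> ('q, 'j, 'w::real_normed_vector) manifold \<Rightarrow>
   ('p \<Rightarrow> 'q) \<Rightarrow> 'i \<Rightarrow> 'j \<Rightarrow> 'p \<Rightarrow> 'v \<Rightarrow> 'w" where
  "differential M N f i j x = frechet_derivative (local_rep M N f i j) (at (chart M i x))"

definition diffeo ::
  "('p, 'i, 'v::real_normed_vector) manifold \<Rightarrow> ('q, 'j, 'w::real_normed_vector) manifold \<Rightarrow>
   ('p \<Rightarrow> 'q) \<Rightarrow> bool" where
  "diffeo M N f \<longleftrightarrow>
     bij_betw f (pts M) (pts N) \<and> smooth_map M N f \<and> smooth_map N M (inv_into (pts M) f)"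

definition submersion ::
  "('p, 'i, 'v::real_normed_vector) manifold \<Rightarrow> ('q, 'j, 'w::real_normed_vector) manifold \<Rightarrow>
   ('p \<Rightarrow> 'q) \<Rightarrow> bool" where
  "submersion M N f \<longleftrightarrow>
     smooth_map M N f \<and>
     (\<forall>x\<in>pts M. \<forall>i\<in>charts_at M x. \<forall>j\<in>charts_at N (f x). surj (differential M N f i j x))"

text \<open>An open subset of a vector space, with the identity as its only chart.\<close>

definition open_mfd :: "'v::real_normed_vector set \<Rightarrow> ('v, unit, 'v) manifold" where
  "open_mfd U = \<lparr>mtop = top_of_set U, idx = UNIV, cdom = (\<lambda>_. U), chart = (\<lambda>_ x. x)\<rparr>"

definition prod_mfd ::
  "('p, 'i, 'v) manifold \<Rightarrow> ('q, 'j, 'w) manifold \<Rightarrow> ('p \<times> 'q, 'i \<times> 'j, 'v \<times> 'w) manifold" where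
  "prod_mfd M N =
     \<lparr>mtop = prod_topology (mtop M) (mtop N), idx = idx M \<times> idx N,
      cdom = (\<lambda>(i, j). cdom M i \<times> cdom N j),
      chart = (\<lambda>(i, j). map_prod (chart M i) (chart N j))\<rparr>"

section \<open>Pseudo-Riemannian metrics\<close>

definition nondegenerate_on :: "('v \<Rightarrow> 'v \<Rightarrow> real) \<Rightarrow> 'v::real_vector set \<Rightarrow> bool" where
  "nondegenerate_on b T \<longleftrightarrow> (\<forall>v\<in>T. (\<forall>w\<in>T. b v w = 0) \<longrightarrow> v = 0)"

text \<open>\<open>g i y\<close> is the bilinear form of the metric in chart \<open>i\<close> at the coordinate point \<open>y\<close>.\<close>

type_synonym ('i, 'v) metric_tensor = "'i \<Rightarrow> 'v \<Rightarrow> 'v \<Rightarrow> 'v \<Rightarrow> real"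

definition metric_preserving ::
  "('p, 'i, 'v::real_normed_vector) manifold \<Rightarrow> ('i, 'v) metric_tensor \<Rightarrow>
   ('q, 'j, 'w::real_normed_vector) manifold \<Rightarrow> ('j, 'w) metric_tensor \<Rightarrow> ('p \<Rightarrow> 'q) \<Rightarrow> bool" where
  "metric_preserving M g N k f \<longleftrightarrow>
     (\<forall>x\<in>pts M. \<forall>i\<in>charts_at M x. \<forall>j\<in>charts_at N (f x). \<forall>v w.
        k j (chart N j (f x)) (differential M N f i j x v) (differential M N f i j x w)
          = g i (chart M i x) v w)"

text \<open>The last condition is the transformation law under change of charts.\<close>

definition pseudo_riemannian_metric ::
  "('p, 'i, 'v::real_normed_vector) manifold \<Rightarrow> ('i, 'v) metric_tensor \<Rightarrow> bool" where
  "pseudo_riemannian_metric M g \<longleftrightarrow>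
     (\<forall>i\<in>idx M.
        (\<forall>y\<in>crange M i. bilinear (g i y) \<and> (\<forall>v w. g i y v w = g i y w v) \<and>
           nondegenerate_on (g i y) UNIV) \<and>
        (\<forall>v w. smooth_on (crange M i) (\<lambda>y. g i y v w))) \<and>
     metric_preserving M g M g (\<lambda>x. x)"

definition prod_metric ::
  "('i, 'v) metric_tensor \<Rightarrow> ('j, 'w) metric_tensor \<Rightarrow> ('i \<times> 'j, 'v \<times> 'w) metric_tensor" where
  "prod_metric g k =
     (\<lambda>(i, j) y v w. g i (fst y) (fst v) (fst w) + k j (snd y) (snd v) (snd w))"

definition line_metric :: "real \<Rightarrow> (unit, real) metric_tensor" where
  "line_metric \<epsilon> = (\<lambda>_ _ v w. \<epsilon> * v * w)"

definition gradient ::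
  "('p, 'i, 'v::real_normed_vector) manifold \<Rightarrow> ('i, 'v) metric_tensor \<Rightarrow> ('p \<Rightarrow> real) \<Rightarrow>
   'i \<Rightarrow> 'p \<Rightarrow> 'v" where
  "gradient M g u i x =
     (THE z. \<forall>w. g i (chart M i x) z w = frechet_derivative (u \<circ> param M i) (at (chart M i x)) w)"

definition pseudo_riemannian_submersion ::
  "('p, 'i, 'v::real_normed_vector) manifold \<Rightarrow> ('i, 'v) metric_tensor \<Rightarrow>
   ('q, 'j, 'w::real_normed_vector) manifold \<Rightarrow> ('j, 'w) metric_tensor \<Rightarrow> ('p \<Rightarrow> 'q) \<Rightarrow> bool" where
  "pseudo_riemannian_submersion M g N k f \<longleftrightarrow>
     f ` pts M = pts N \<and> submersion M N f \<and>
     (\<forall>x\<in>pts M. \<forall>i\<in>charts_at M x. \<forall>j\<in>charts_at N (f x).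
        let D = differential M N f i j x;
            b = g i (chart M i x);
            V = {v. D v = 0};
            H = {v. \<forall>w\<in>V. b v w = 0}
        in nondegenerate_on b V \<and>
           (\<forall>v\<in>H. \<forall>w\<in>H. k j (chart N j (f x)) (D v) (D w) = b v w))"

text \<open>The bilinear map \<open>\<Gamma>(u, v)\<close> of the Levi-Civita connection in chart \<open>i\<close> (Koszul formula for
  constant vector fields), and the covariant derivative of a vector field along \<open>u\<close>.\<close>

definition christoffel ::
  "('i, 'v::real_normed_vector) metric_tensor \<Rightarrow> 'i \<Rightarrow> 'v \<Rightarrow> 'v \<Rightarrow> 'v \<Rightarrow> 'v" where
  "christoffel g i y u v =
     (let D = (\<lambda>a b c. frechet_derivative (\<lambda>z. g i z b c) (at y) a)
      in THE z. \<forall>w. g i y z w = (D u v w + D v u w - D w u v) / 2)"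

definition cov_deriv ::
  "('i, 'v::real_normed_vector) metric_tensor \<Rightarrow> 'i \<Rightarrow> ('v \<Rightarrow> 'v) \<Rightarrow> 'v \<Rightarrow> 'v \<Rightarrow> 'v" where
  "cov_deriv g i Y y u = frechet_derivative Y (at y) u + christoffel g i y u (Y y)"

section \<open>Hypersurfaces and mean curvature\<close>

text \<open>Embedded submanifolds of codimension one, as local regular zero sets.\<close>

definition hypersurface :: "('p, 'i, 'v::real_normed_vector) manifold \<Rightarrow> 'p set \<Rightarrow> bool" where
  "hypersurface M S \<longleftrightarrow>
     S \<subseteq> pts M \<and>
     (\<forall>p\<in>S. \<exists>i\<in>charts_at M p. \<exists>V (\<rho>::'v \<Rightarrow> real).
        open V \<and> chart M i p \<in> V \<and> V \<subseteq> crange M i \<and> smooth_on V \<rho> \<and>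
        (\<forall>y\<in>V. frechet_derivative \<rho> (at y) \<noteq> (\<lambda>_. 0)) \<and>
        (\<forall>x\<in>cdom M i. chart M i x \<in> V \<longrightarrow> (x \<in> S \<longleftrightarrow> \<rho> (chart M i x) = 0)))"

text \<open>Components in chart \<open>i\<close> of the velocities at \<open>p\<close> of curves in \<open>S\<close>.\<close>

definition tangent_space ::
  "('p, 'i, 'v::real_normed_vector) manifold \<Rightarrow> 'p set \<Rightarrow> 'i \<Rightarrow> 'p \<Rightarrow> 'v set" where
  "tangent_space M S i p =
     {v. \<exists>\<gamma>::real \<Rightarrow> 'p. \<gamma> 0 = p \<and> (\<forall>\<^sub>F t in nhds 0. \<gamma> t \<in> S \<inter> cdom M i) \<and>
           ((chart M i \<circ> \<gamma>) has_vector_derivative v) (at 0)}"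

definition nondegenerate_hypersurface ::
  "('p, 'i, 'v::real_normed_vector) manifold \<Rightarrow> ('i, 'v) metric_tensor \<Rightarrow> 'p set \<Rightarrow> bool" where
  "nondegenerate_hypersurface M g S \<longleftrightarrow>
     hypersurface M S \<and>
     (\<forall>p\<in>S. \<forall>i\<in>charts_at M p. nondegenerate_on (g i (chart M i p)) (tangent_space M S i p))"

definition normal_part ::
  "('v \<Rightarrow> 'v \<Rightarrow> real) \<Rightarrow> 'v::real_vector set \<Rightarrow> 'v \<Rightarrow> 'v" where
  "normal_part b T z = (THE n. (\<forall>w\<in>T. b n w = 0) \<and> z - n \<in> T)"

text \<open>\<open>II(u, v) = (\<nabla>\<^sub>u Y)\<^sup>\<bottom>\<close> for any local extension \<open>Y\<close> of \<open>v\<close> that is tangent to \<open>S\<close> along \<open>S\<close>.\<close>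

definition tangent_extension ::
  "('p, 'i, 'v::real_normed_vector) manifold \<Rightarrow> 'p set \<Rightarrow> 'i \<Rightarrow> 'p \<Rightarrow> 'v \<Rightarrow> ('v \<Rightarrow> 'v) \<Rightarrow> bool" where
  "tangent_extension M S i p v Y \<longleftrightarrow>
     (\<exists>V. open V \<and> chart M i p \<in> V \<and> V \<subseteq> crange M i \<and> smooth_on V Y \<and> Y (chart M i p) = v \<and>
        (\<forall>x\<in>S \<inter> cdom M i. chart M i x \<in> V \<longrightarrow> Y (chart M i x) \<in> tangent_space M S i x))"

definition second_fundamental_form ::
  "('p, 'i, 'v::real_normed_vector) manifold \<Rightarrow> ('i, 'v) metric_tensor \<Rightarrow> 'p set \<Rightarrow> 'i \<Rightarrow> 'p \<Rightarrow>
   'v \<Rightarrow> 'v \<Rightarrow> 'v" where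
  "second_fundamental_form M g S i p u v =
     (THE z. \<exists>Y. tangent_extension M S i p v Y \<and>
        z = normal_part (g i (chart M i p)) (tangent_space M S i p)
              (cov_deriv g i Y (chart M i p) u))"

definition orthonormal_basis_of ::
  "('v \<Rightarrow> 'v \<Rightarrow> real) \<Rightarrow> 'v::real_vector set \<Rightarrow> 'v set \<Rightarrow> bool" where
  "orthonormal_basis_of b T E \<longleftrightarrow>
     finite E \<and> E \<subseteq> T \<and> span E = T \<and> (\<forall>e\<in>E. b e e \<in> {1, -1}) \<and>
     (\<forall>e\<in>E. \<forall>e'\<in>E. e \<noteq> e' \<longrightarrow> b e e' = 0)"

text \<open>Trace with respect to \<open>b\<close>; the sum does not depend on the orthonormal basis when \<open>B\<close> is
  bilinear and \<open>b\<close> is symmetric, bilinear and nondegenerate on \<open>T\<close>.\<close>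

definition metric_trace ::
  "('v \<Rightarrow> 'v \<Rightarrow> real) \<Rightarrow> 'v::real_vector set \<Rightarrow> ('v \<Rightarrow> 'v \<Rightarrow> 'v) \<Rightarrow> 'v" where
  "metric_trace b T B = (THE z. \<exists>E. orthonormal_basis_of b T E \<and> z = (\<Sum>e\<in>E. b e e *\<^sub>R B e e))"

definition mean_curvature_vector ::
  "('p, 'i, 'v::real_normed_vector) manifold \<Rightarrow> ('i, 'v) metric_tensor \<Rightarrow> 'p set \<Rightarrow> 'i \<Rightarrow> 'p \<Rightarrow> 'v"
  where
  "mean_curvature_vector M g S i p =
     metric_trace (g i (chart M i p)) (tangent_space M S i p) (second_fundamental_form M g S i p)"

text \<open>\<open>H\<close> is the mean curvature function of \<open>S\<close> with respect to the unit normal field with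
  components \<open>\<nu> i p\<close> in chart \<open>i\<close>: the mean curvature vector is \<open>\<langle>\<nu>, \<nu>\<rangle> H \<nu>\<close>.\<close>

definition has_mean_curvature ::
  "('p, 'i, 'v::real_normed_vector) manifold \<Rightarrow> ('i, 'v) metric_tensor \<Rightarrow> 'p set \<Rightarrow>
   ('i \<Rightarrow> 'p \<Rightarrow> 'v) \<Rightarrow> ('p \<Rightarrow> real) \<Rightarrow> bool" where
  "has_mean_curvature M g S \<nu> H \<longleftrightarrow>
     nondegenerate_hypersurface M g S \<and>
     (\<forall>p\<in>S. \<forall>i\<in>charts_at M p.
        let b = g i (chart M i p); n = \<nu> i p
        in (\<forall>w\<in>tangent_space M S i p. b n w = 0) \<and> b n n \<in> {1, -1} \<and>
           mean_curvature_vector M g S i p = (b n n * H p) *\<^sub>R n)"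

section \<open>Translating solitons\<close>

abbreviation times_line ::
  "('p, 'i, 'v::real_normed_vector) manifold \<Rightarrow> ('p \<times> real, 'i \<times> unit, 'v \<times> real) manifold" where
  "times_line M \<equiv> prod_mfd M (open_mfd UNIV)"

text \<open>In the charts of \<^term>\<open>times_line M\<close> the vector field \<open>\<partial>\<^sub>t\<close> is \<^term>\<open>(0, 1)\<close>.\<close>

definition translating_soliton ::
  "('p, 'i, 'v::real_normed_vector) manifold \<Rightarrow> ('i, 'v) metric_tensor \<Rightarrow> real \<Rightarrow>
   ('p \<times> real) set \<Rightarrow> bool" where
  "translating_soliton M g \<epsilon>' S \<longleftrightarrow>
     (let P = times_line M; G = prod_metric g (line_metric \<epsilon>')
      in nondegenerate_hypersurface P G S \<and>
         (\<forall>p\<in>S. \<forall>i\<in>charts_at P p.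
            mean_curvature_vector P G S i p
              = normal_part (G i (chart P i p)) (tangent_space P S i p) (0, 1)))"

definition graph_on :: "'p set \<Rightarrow> ('p \<Rightarrow> real) \<Rightarrow> ('p \<times> real) set" where
  "graph_on D u = (\<lambda>x. (x, u x)) ` D"

definition invariant_under ::
  "('s, 'z) monoid_scheme \<Rightarrow> ('s \<Rightarrow> 'p \<Rightarrow> 'p) \<Rightarrow> ('p \<times> real) set \<Rightarrow> bool" where
  "invariant_under G \<phi> S \<longleftrightarrow> (\<forall>\<sigma>\<in>carrier G. (\<lambda>(x, t). (\<phi> \<sigma> x, t)) ` S = S)"

section \<open>Lie groups and decomposable manifolds\<close>

definition lie_group ::
  "('s, 'k, 'l::real_normed_vector) manifold \<Rightarrow> ('s, 'z) monoid_scheme \<Rightarrow> bool" where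
  "lie_group L G \<longleftrightarrow>
     smooth_manifold L \<and> group G \<and> carrier G = pts L \<and>
     smooth_map (prod_mfd L L) L (\<lambda>(a, b). a \<otimes>\<^bsub>G\<^esub> b) \<and> smooth_map L L (\<lambda>a. inv\<^bsub>G\<^esub> a)"

definition proper_isometric_action ::
  "('s, 'k, 'l::real_normed_vector) manifold \<Rightarrow> ('s, 'z) monoid_scheme \<Rightarrow>
   ('p, 'i, 'v::real_normed_vector) manifold \<Rightarrow> ('i, 'v) metric_tensor \<Rightarrow>
   ('s \<Rightarrow> 'p \<Rightarrow> 'p) \<Rightarrow> bool" where
  "proper_isometric_action L G M g \<phi> \<longleftrightarrow>
     group_action G (pts M) \<phi> \<and>
     smooth_map (prod_mfd L M) M (\<lambda>(\<sigma>, x). \<phi> \<sigma> x) \<and>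
     proper_map (prod_topology (mtop L) (mtop M)) (prod_topology (mtop M) (mtop M))
       (\<lambda>(\<sigma>, x). (\<phi> \<sigma> x, x)) \<and>
     (\<forall>\<sigma>\<in>carrier G. metric_preserving M g M g (\<phi> \<sigma>))"

text \<open>The smooth structure on the set of left cosets is determined (up to the choice of atlas) by
  the requirement that the projection be a submersion.\<close>

definition homogeneous_space ::
  "('s, 'k, 'l::real_normed_vector) manifold \<Rightarrow> ('s, 'z) monoid_scheme \<Rightarrow> 's set \<Rightarrow>
   ('s set, 'j, 'q::real_normed_vector) manifold \<Rightarrow> bool" where
  "homogeneous_space L G K Q \<longleftrightarrow>
     smooth_manifold Q \<and> pts Q = (\<lambda>\<sigma>. \<sigma> <#\<^bsub>G\<^esub> K) ` carrier G \<and>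
     submersion L Q (\<lambda>\<sigma>. \<sigma> <#\<^bsub>G\<^esub> K)"

definition unit_curve_orthogonal_to_orbits ::
  "('p, 'i, 'v::real_normed_vector) manifold \<Rightarrow> ('i, 'v) metric_tensor \<Rightarrow> ('s, 'z) monoid_scheme \<Rightarrow>
   ('s \<Rightarrow> 'p \<Rightarrow> 'p) \<Rightarrow> real set \<Rightarrow> (real \<Rightarrow> 'p) \<Rightarrow> bool" where
  "unit_curve_orthogonal_to_orbits M g G \<phi> I \<beta> \<longleftrightarrow>
     smooth_map (open_mfd I) M \<beta> \<and>
     (\<forall>s\<in>I. \<forall>i\<in>charts_at M (\<beta> s).
        let b = g i (chart M i (\<beta> s)); v = vector_derivative (chart M i \<circ> \<beta>) (at s)
        in b v v \<in> {1, -1} \<and> (\<forall>w\<in>tangent_space M (orbit G \<phi> (\<beta> s)) i (\<beta> s). b v w = 0))"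

definition decomposable ::
  "('p, 'i, 'v::real_normed_vector) manifold \<Rightarrow> ('i, 'v) metric_tensor \<Rightarrow>
   ('s, 'k, 'l::real_normed_vector) manifold \<Rightarrow> ('s, 'z) monoid_scheme \<Rightarrow> ('s \<Rightarrow> 'p \<Rightarrow> 'p) \<Rightarrow>
   ('s set, 'j, 'q::real_normed_vector) manifold \<Rightarrow>
   real set \<Rightarrow> ('p \<Rightarrow> real) \<Rightarrow> real \<Rightarrow> (real \<Rightarrow> real) \<Rightarrow> bool" where
  "decomposable M g L G \<phi> Q I \<pi> \<epsilon> h \<longleftrightarrow>
     smooth_manifold M \<and> pseudo_riemannian_metric M g \<and>
     lie_group L G \<and> proper_isometric_action L G M g \<phi> \<and>
     (\<forall>x\<in>pts M. hypersurface M (orbit G \<phi> x)) \<and>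
     open I \<and> is_interval I \<and> I \<noteq> {} \<and> \<epsilon> \<in> {1, -1} \<and>
     pseudo_riemannian_submersion M g (open_mfd I) (line_metric \<epsilon>) \<pi> \<and>
     (\<forall>x\<in>pts M. \<forall>i\<in>charts_at M x.
        g i (chart M i x) (gradient M g \<pi> i x) (gradient M g \<pi> i x) = \<epsilon>) \<and>
     (\<forall>x\<in>pts M. {y \<in> pts M. \<pi> y = \<pi> x} = orbit G \<phi> x) \<and>
     smooth_on I h \<and>
     (\<forall>s\<in>I. has_mean_curvature M g {x \<in> pts M. \<pi> x = s} (\<lambda>i x. - gradient M g \<pi> i x) (\<lambda>_. h s)) \<and>
     (\<exists>x0\<in>pts M. \<exists>\<beta> \<Phi>.
        homogeneous_space L G (stabilizer G \<phi> x0) Q \<and>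
        unit_curve_orthogonal_to_orbits M g G \<phi> I \<beta> \<and>
        diffeo (prod_mfd (open_mfd I) Q) M \<Phi> \<and>
        (\<forall>s\<in>I. \<forall>\<sigma>\<in>carrier G.
           \<Phi> (s, \<sigma> <#\<^bsub>G\<^esub> stabilizer G \<phi> x0) = \<phi> \<sigma> (\<beta> s) \<and>
           \<pi> (\<Phi> (s, \<sigma> <#\<^bsub>G\<^esub> stabilizer G \<phi> x0)) = s))"

section \<open>The ordinary differential equation\<close>

definition soliton_ode_solution ::
  "real \<Rightarrow> real \<Rightarrow> (real \<Rightarrow> real) \<Rightarrow> real set \<Rightarrow> (real \<Rightarrow> real) \<Rightarrow> bool" where
  "soliton_ode_solution \<epsilon> \<epsilon>' h J f \<longleftrightarrow>
     (\<forall>s\<in>J. f differentiable (at s) \<and>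
        (deriv f has_real_derivative (\<epsilon> + \<epsilon>' * (deriv f s)\<^sup>2) * (1 - deriv f s * h s)) (at s))"

end

theory Submission
  imports Defs
begin

text \<open>In terms of \<open>w = f' = tanh \<theta>\<close> the equation reads \<open>\<theta>' = \<epsilon> (1 - h tanh \<theta>)\<close>; its right-hand side is
  Lipschitz in \<open>\<theta>\<close>, locally uniformly on \<open>I\<close>, so solutions exist on all of \<open>I\<close> and satisfy
  \<open>(f')\<^sup>2 < 1\<close>.

  For the geometry, a level set of a regular function \<open>\<rho>\<close> with gradient \<open>n\<close> has mean curvature vector
  \<open>- (tr Hess \<rho> / \<langle>n, n\<rangle>) n\<close>, the trace being taken over \<open>ker d\<rho>\<close>. Applied to the fibres of \<open>\<pi>\<close>, this
  identifies the trace of \<open>Hess \<pi>\<close> over \<open>ker d\<pi>\<close> with \<open>h\<close>, and \<open>Hess \<pi>(\<nabla>\<pi>, \<cdot>) = 0\<close> because \<open>\<nabla>\<pi>\<close> has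
  constant length. The graph of \<open>F \<circ> \<pi>\<close> is the zero set of \<open>\<rho> = t - F \<circ> \<pi>\<close>, with gradient
  \<open>(- F' \<nabla>\<pi>, \<epsilon>')\<close>, and an orthonormal basis of its tangent space consists of one of \<open>ker d\<pi>\<close> together with
  \<open>(\<nabla>\<pi>, \<epsilon> F') / sqrt (1 - (F')\<^sup>2)\<close>. The trace of \<open>Hess \<rho>\<close> over it is
  \<open>- F' h - \<epsilon> F'' / (1 - (F')\<^sup>2)\<close>, so the soliton equation, which asks for the value \<open>-1\<close>, is the
  differential equation.\<close>

section \<open>Smooth maps on open sets\<close>

text \<open>Because \<epsilon> \<epsilon>' = -1, the right-hand side factors as \<epsilon> (1 - w^2)
  (1 - w h) with w = f'. It is cubic in w, hence not Lipschitz, but the constants w = 1 and w = -1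
  solve the equation for the slope and act as barriers. The substitution by tanh moves them to
  infinity and cancels the factor 1 - w^2, which is the derivative of tanh. The same inequality w^2
  < 1 keeps the normal of the graph from being null: its square is \<epsilon>' (1 - w^2). One bound
  thus yields both global existence and nondegeneracy. The gradient, the Christoffel map, the normal
  part, the second fundamental form and the trace are definite descriptions, so each requires
  existence and independence of choices (tangent extension, orthonormal basis). To keep this small,
  normal vectors are determined only through their product with n, and the Christoffel map enters
  only through the Koszul expression with n in the last slot.\<close>

lemma Ck_on_imp_continuous_on: "Ck_on k U f \<Longrightarrow> continuous_on U f"
proof (cases k)
  case (Suc m)
  assume "Ck_on k U f"
  then show ?thesis
    using differentiable_imp_continuous_within[of f _ UNIV]
    by (intro continuous_at_imp_continuous_on) (auto simp: Suc)
qed simp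

lemma Ck_on_SucD: "Ck_on (Suc k) U f \<Longrightarrow> Ck_on k U f"
proof (induction k arbitrary: f)
  case 0
  then show ?case
    using Ck_on_imp_continuous_on[of "Suc 0" U f] by simp
next
  case (Suc k)
  then show ?case
    using Ck_on.simps(2)[of k U f] Ck_on.simps(2)[of "Suc k" U f] by blast
qed

lemma Ck_on_subset: "Ck_on k U f \<Longrightarrow> V \<subseteq> U \<Longrightarrow> Ck_on k V f"
proof (induction k arbitrary: f)
  case 0
  then show ?case by (auto intro: continuous_on_subset)
qed auto

lemma has_derivative_frechet:
  "f differentiable (at x) \<Longrightarrow> (f has_derivative frechet_derivative f (at x)) (at x)"
  by (simp add: frechet_derivative_works)

lemma frechet_derivative_eqI: "(f has_derivative D) (at x) \<Longrightarrow> frechet_derivative f (at x) = D"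
  using frechet_derivative_at[of f D x] by simp

text \<open>Derivatives at a point of the open set \<open>U\<close> see only values in
  \<open>U\<close>, at every order.\<close>

lemma Ck_on_cong:
  assumes "open U" "\<And>x. x \<in> U \<Longrightarrow> f x = g x"
  shows "Ck_on k U f \<longleftrightarrow> Ck_on k U g"
proof -
  have *: "Ck_on k U g" if "Ck_on k U f" "\<And>x. x \<in> U \<Longrightarrow> f x = g x" for f g :: "'a \<Rightarrow> 'b"
    using that
  proof (induction k arbitrary: f g)
    case 0
    then show ?case by (simp cong: continuous_on_cong)
  next
    case (Suc k)
    have D: "(g has_derivative frechet_derivative f (at x)) (at x)" if "x \<in> U" for x
    proof -
      have "f differentiable (at x)" using Suc.prems(1) that by simp
      from has_derivative_frechet[OF this] show ?thesis
        using \<open>open U\<close> that Suc.prems(2) by (rule has_derivative_transform_within_open)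
    qed
    have "Ck_on k U (\<lambda>x. frechet_derivative g (at x) v)" for v
      by (rule Suc.IH[of "\<lambda>x. frechet_derivative f (at x) v"])
        (use Suc.prems(1) frechet_derivative_eqI[OF D] in auto)
    moreover have "g differentiable (at x)" if "x \<in> U" for x
      using D[OF that] by (rule differentiableI)
    ultimately show ?case by simp
  qed
  show ?thesis using *[of f g] *[of g f] assms(2) by auto
qed

text \<open>\<open>Ck_on\<close> speaks of \<open>frechet_derivative\<close>; here an explicit
  formula, valid on \<open>U\<close> only, takes its place. This drives the inductions for sums,
  products, inverses and compositions.\<close>

lemma Ck_on_SucI:
  assumes "open U" "\<And>x. x \<in> U \<Longrightarrow> (f has_derivative D x) (at x)"
    "\<And>v. Ck_on k U (\<lambda>x. D x v)"
  shows "Ck_on (Suc k) U f"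
proof -
  have "Ck_on k U (\<lambda>x. frechet_derivative f (at x) v)" for v
    using Ck_on_cong[OF assms(1), of "\<lambda>x. frechet_derivative f (at x) v" "\<lambda>x. D x v" k] assms(2,3)
    using frechet_derivative_eqI[OF assms(2)] by simp
  then show ?thesis using assms(2) by (auto intro: differentiableI)
qed

lemma Ck_on_SucE:
  assumes "Ck_on (Suc k) U f"
  shows "\<And>x. x \<in> U \<Longrightarrow> (f has_derivative frechet_derivative f (at x)) (at x)"
    "\<And>v. Ck_on k U (\<lambda>x. frechet_derivative f (at x) v)" "Ck_on k U f"
  using assms Ck_on_SucD[OF assms] by (auto intro: has_derivative_frechet)

lemma Ck_on_const: "Ck_on k U (\<lambda>x. c)"
  by (induction k arbitrary: c) (auto simp: frechet_derivative_const)

lemma Ck_on_bounded_linear_comp: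
  assumes "bounded_linear L" "open U" "Ck_on k U f"
  shows "Ck_on k U (\<lambda>x. L (f x))"
  using assms(3)
proof (induction k arbitrary: f)
  case 0
  then show ?case using assms(1) by (simp add: bounded_linear.continuous_on)
next
  case (Suc k)
  note S = Ck_on_SucE[OF Suc.prems]
  show ?case
    by (rule Ck_on_SucI[OF assms(2), where D="\<lambda>x v. L (frechet_derivative f (at x) v)"])
      (auto intro!: Suc.IH S bounded_linear.has_derivative[OF assms(1)])
qed

lemma Ck_on_id: "Ck_on k U (\<lambda>x. x)"
proof (cases k)
  case (Suc m)
  then show ?thesis by (auto simp: Ck_on_const frechet_derivative_id)
qed simp

lemma Ck_on_bounded_linear: "bounded_linear L \<Longrightarrow> open U \<Longrightarrow> Ck_on k U L"
  using Ck_on_bounded_linear_comp[OF _ _ Ck_on_id] .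

lemma Ck_on_add:
  assumes "open U" "Ck_on k U f" "Ck_on k U g"
  shows "Ck_on k U (\<lambda>x. f x + g x)"
  using assms(2,3)
proof (induction k arbitrary: f g)
  case 0
  then show ?case by (simp add: continuous_on_add)
next
  case (Suc k)
  note S = Ck_on_SucE[OF Suc.prems(1)] Ck_on_SucE[OF Suc.prems(2)]
  show ?case
    by (rule Ck_on_SucI[OF assms(1), where
          D="\<lambda>x v. frechet_derivative f (at x) v + frechet_derivative g (at x) v"])
      (auto intro!: Suc.IH S has_derivative_add)
qed

lemma Ck_on_sum:
  assumes "open U" "\<And>i. i \<in> A \<Longrightarrow> Ck_on k U (f i)"
  shows "Ck_on k U (\<lambda>x. \<Sum>i\<in>A. f i x)"
  using assms(2) by (induction A rule: infinite_finite_induct)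
    (auto intro!: Ck_on_const Ck_on_add[OF assms(1)])

lemma Ck_on_scaleR:
  assumes "open U" "Ck_on k U f" "Ck_on k U g"
  shows "Ck_on k U (\<lambda>x. f x *\<^sub>R g x)"
  using assms(2,3)
proof (induction k arbitrary: f g)
  case 0
  then show ?case by (simp add: continuous_on_scaleR)
next
  case (Suc k)
  note S = Ck_on_SucE[OF Suc.prems(1)] Ck_on_SucE[OF Suc.prems(2)]
  show ?case
    by (rule Ck_on_SucI[OF assms(1), where
          D="\<lambda>x v. f x *\<^sub>R frechet_derivative g (at x) v + frechet_derivative f (at x) v *\<^sub>R g x"])
      (auto intro!: Suc.IH S Ck_on_add[OF assms(1)] has_derivative_scaleR)
qed

lemma Ck_on_mult:
  fixes f g :: "_ \<Rightarrow> real"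
  assumes "open U" "Ck_on k U f" "Ck_on k U g"
  shows "Ck_on k U (\<lambda>x. f x * g x)"
  using Ck_on_scaleR[OF assms] by simp

lemma Ck_on_diff:
  assumes "open U" "Ck_on k U f" "Ck_on k U g"
  shows "Ck_on k U (\<lambda>x. f x - g x)"
  using Ck_on_add[OF assms(1,2) Ck_on_bounded_linear_comp[OF bounded_linear_minus[OF bounded_linear_ident] assms(1,3)]]
  by simp

text \<open>The derivative of 1/f contains 1/f again, which the induction hypothesis covers at order
  \<open>k\<close>; \<open>f\<close> therefore stays fixed in the induction, unlike in the product
  rule.\<close>

lemma Ck_on_inverse:
  fixes f :: "'a::real_normed_vector \<Rightarrow> real"
  assumes "open U" "Ck_on k U f" "\<And>x. x \<in> U \<Longrightarrow> f x \<noteq> 0"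
  shows "Ck_on k U (\<lambda>x. inverse (f x))"
  using assms(2)
proof (induction k)
  case 0
  then show ?case using assms(3) by (auto intro!: continuous_on_inverse)
next
  case (Suc k)
  note S = Ck_on_SucE[OF Suc.prems]
  have I: "Ck_on k U (\<lambda>x. inverse (f x))" using Suc.IH S(3) .
  have "Ck_on k U (\<lambda>x. - (inverse (f x) * frechet_derivative f (at x) v * inverse (f x)))" for v
    by (intro Ck_on_bounded_linear_comp[OF bounded_linear_minus[OF bounded_linear_ident] assms(1)]
        Ck_on_mult[OF assms(1)] I S)
  then show ?case
    by (intro Ck_on_SucI[OF assms(1), where
          D="\<lambda>x v. - (inverse (f x) * frechet_derivative f (at x) v * inverse (f x))"]
        Deriv.has_derivative_inverse assms(3) S)
qed

lemma Ck_on_Pair: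
  assumes "open U" "Ck_on k U f" "Ck_on k U g"
  shows "Ck_on k U (\<lambda>x. (f x, g x))"
  using assms(2,3)
proof (induction k arbitrary: f g)
  case 0
  then show ?case by (simp add: continuous_on_Pair)
next
  case (Suc k)
  note S = Ck_on_SucE[OF Suc.prems(1)] Ck_on_SucE[OF Suc.prems(2)]
  show ?case
    by (rule Ck_on_SucI[OF assms(1), where
          D="\<lambda>x v. (frechet_derivative f (at x) v, frechet_derivative g (at x) v)"])
      (auto intro!: Suc.IH S has_derivative_Pair)
qed

lemma linear_eq_sum_Basis:
  fixes v :: "'a::euclidean_space"
  assumes "linear L"
  shows "L v = (\<Sum>b\<in>Basis. (v \<bullet> b) *\<^sub>R L b)"
  by (subst euclidean_representation[of v, symmetric])
     (simp add: linear_sum[OF assms] linear_scale[OF assms])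

text \<open>The chain rule evaluates the derivative of \<open>f\<close> in a direction that depends
  on x, while the induction hypothesis handles derivatives of \<open>f\<close> in fixed directions.
  Expanding in \<open>Basis\<close> reduces the former to the latter; this is where the Euclidean
  domain of \<open>f\<close> enters.\<close>

lemma Ck_on_compose:
  fixes f :: "'b::euclidean_space \<Rightarrow> 'c::real_normed_vector"
  assumes "open U" "Ck_on k U g" "Ck_on k V f" "g ` U \<subseteq> V"
  shows "Ck_on k U (\<lambda>x. f (g x))"
  using assms(2,3)
proof (induction k arbitrary: f)
  case 0
  then show ?case using assms(4) by (auto intro: continuous_on_compose2)
next
  case (Suc k)
  note S = Ck_on_SucE[OF Suc.prems(1)] Ck_on_SucE[OF Suc.prems(2)]
  let ?D = "\<lambda>x v. \<Sum>b\<in>Basis. (frechet_derivative g (at x) v \<bullet> b) *\<^sub>R frechet_derivative f (at (g x)) b"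
  have der: "((\<lambda>x. f (g x)) has_derivative ?D x) (at x)" if "x \<in> U" for x
  proof -
    have f: "(f has_derivative frechet_derivative f (at (g x))) (at (g x))"
      using that assms(4) by (intro S) auto
    have "(\<lambda>v. frechet_derivative f (at (g x)) (frechet_derivative g (at x) v)) = ?D x"
      by (rule ext, rule linear_eq_sum_Basis[OF has_derivative_linear[OF f]])
    with has_derivative_compose[OF S(1)[OF that] f] show ?thesis by simp
  qed
  have C: "Ck_on k U (\<lambda>x. ?D x v)" for v
    by (intro Ck_on_sum[OF assms(1)] Ck_on_scaleR[OF assms(1)] Suc.IH S
        Ck_on_bounded_linear_comp[OF bounded_linear_inner_left assms(1)])
  show ?case
    by (rule Ck_on_SucI[OF assms(1), where D="?D"]) (use der C in auto)
qed

lemma smooth_on_differentiable: "smooth_on U f \<Longrightarrow> x \<in> U \<Longrightarrow> f differentiable (at x)"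
  unfolding smooth_on_def using Ck_on.simps(2)[of 0 U f] by blast

lemma smooth_on_has_derivative:
  "smooth_on U f \<Longrightarrow> x \<in> U \<Longrightarrow> (f has_derivative frechet_derivative f (at x)) (at x)"
  by (simp add: smooth_on_differentiable has_derivative_frechet)

lemma smooth_on_frechet: "smooth_on U f \<Longrightarrow> smooth_on U (\<lambda>x. frechet_derivative f (at x) v)"
  unfolding smooth_on_def using Ck_on.simps(2)[of _ U f] by blast

lemma smooth_on_continuous_on: "smooth_on U f \<Longrightarrow> continuous_on U f"
  using Ck_on_imp_continuous_on smooth_on_def by blast

lemma smooth_on_subset: "smooth_on U f \<Longrightarrow> V \<subseteq> U \<Longrightarrow> smooth_on V f"
  using Ck_on_subset unfolding smooth_on_def by blast

lemma smooth_on_compose: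
  fixes f :: "'b::euclidean_space \<Rightarrow> 'c::real_normed_vector"
  assumes "open U" "smooth_on U g" "smooth_on V f" "g ` U \<subseteq> V"
  shows "smooth_on U (\<lambda>x. f (g x))"
  using assms unfolding smooth_on_def by (blast intro: Ck_on_compose)

section \<open>Symmetric bilinear forms\<close>

text \<open>The map z -> b(z, .) into the dual space, in coordinates; nondegeneracy says that its
  kernel is trivial.\<close>

lemma nondegenerate_components:
  fixes b :: "'v::euclidean_space \<Rightarrow> 'v \<Rightarrow> real"
  assumes b: "bilinear b" and nd: "nondegenerate_on b UNIV"
  shows "linear (\<lambda>z. \<Sum>c\<in>Basis. b z c *\<^sub>R c)" "inj (\<lambda>z. \<Sum>c\<in>Basis. b z c *\<^sub>R c)"
proof -
  let ?A = "\<lambda>z. \<Sum>c\<in>Basis. b z c *\<^sub>R c"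
  show A: "linear ?A"
    using b
    by (auto intro!: linearI simp: bilinear_ladd bilinear_lmul scaleR_add_left sum.distrib scaleR_sum_right)
  show "inj ?A"
  proof (rule linear_injective_0[OF A, THEN iffD2], intro allI impI)
    fix z assume z: "?A z = 0"
    have "b z c = ?A z \<bullet> c" if "c \<in> Basis" for c
      using that by (simp add: inner_sum_left inner_Basis if_distrib cong: if_cong)
    then have "b z w = 0" for w
      using linear_eq_0_on_span[of "b z" "Basis :: 'v set" w] z b by (auto simp: bilinear_def)
    then show "z = 0" using nd by (auto simp: nondegenerate_on_def)
  qed
qed

text \<open>In finite dimension the injective component map is onto. This gives the definite
  descriptions of \<open>gradient\<close> and \<open>christoffel\<close> their values.\<close>

lemma bilinear_riesz:
  fixes b :: "'v::euclidean_space \<Rightarrow> 'v \<Rightarrow> real"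
  assumes b: "bilinear b" and nd: "nondegenerate_on b UNIV" and l: "linear l"
  shows "\<exists>!z. \<forall>w. b z w = l w"
proof -
  let ?A = "\<lambda>z. \<Sum>c\<in>Basis. b z c *\<^sub>R c"
  have eq: "z = z'" if "\<forall>w. b z w = b z' w" for z z'
  proof -
    have "\<forall>w. b (z - z') w = 0" using that by (simp add: bilinear_lsub[OF b])
    then show ?thesis using nd unfolding nondegenerate_on_def by fastforce
  qed
  have sj: "surj ?A"
    using nondegenerate_components[OF b nd] linear_injective_imp_surjective by blast
  obtain z where z: "(\<Sum>c\<in>Basis. l c *\<^sub>R c) = ?A z" by (rule surjE[OF sj])
  have "b z c = l c" if "c \<in> Basis" for c
    using arg_cong[OF z, of "\<lambda>x. x \<bullet> c"] that
    by (simp add: inner_sum_left inner_Basis if_distrib cong: if_cong)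
  then have "b z = l" using linear_eq_stdbasis[of "b z" l] b l by (auto simp: bilinear_def)
  then show ?thesis using eq by metis
qed

lemma subspace_orthogonal: "bilinear b \<Longrightarrow> subspace {w. b n w = (0::real)}"
  by (auto simp: subspace_def bilinear_rzero bilinear_radd bilinear_rmul)

text \<open>Gram-Schmidt for an indefinite form. A nonzero nondegenerate \<open>T\<close> contains a
  vector of nonzero square, for otherwise polarization makes b vanish on \<open>T\<close>; once it
  is normalized and split off, its complement in \<open>T\<close> is smaller and again
  nondegenerate.\<close>

lemma orthonormal_basis_exists:
  fixes b :: "'v::euclidean_space \<Rightarrow> 'v \<Rightarrow> real"
  assumes b: "bilinear b" and sym: "\<And>v w. b v w = b w v"
    and "subspace T" and "nondegenerate_on b T"
  shows "\<exists>E. orthonormal_basis_of b T E"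
  using assms(3,4)
proof (induction "dim T" arbitrary: T rule: less_induct)
  case less
  note bs = bilinear_ladd[OF b] bilinear_radd[OF b] bilinear_lmul[OF b] bilinear_rmul[OF b]
    bilinear_rsub[OF b] bilinear_lsub[OF b] bilinear_rzero[OF b] bilinear_lzero[OF b]
  show ?case
  proof (cases "\<forall>v\<in>T. b v v = 0")
    case True
    have "b v w = 0" if "v \<in> T" "w \<in> T" for v w
    proof -
      have "b (v + w) (v + w) = 0" using True that less.prems(1) subspace_add by blast
      then show ?thesis using True that sym[of v w] by (simp add: bs)
    qed
    then have "T = {0}"
      using less.prems subspace_0 unfolding nondegenerate_on_def by blast
    then have "orthonormal_basis_of b T {}" by (simp add: orthonormal_basis_of_def)
    then show ?thesis ..
  next
    case False
    then obtain v where v: "v \<in> T" "b v v \<noteq> 0" by blast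
    define e where "e = (1 / sqrt \<bar>b v v\<bar>) *\<^sub>R v"
    have eT: "e \<in> T" using v less.prems(1) by (simp add: e_def subspace_scale)
    have "b e e = b v v / \<bar>b v v\<bar>"
      using v by (simp add: e_def bs flip: power2_eq_square)
    then have ee: "b e e \<in> {1, -1}" using v by (auto simp: abs_if)
    define T' where "T' = {w \<in> T. b e w = 0}"
    have T': "subspace T'"
      using subspace_inter[OF less.prems(1) subspace_orthogonal[OF b]]
      by (simp add: T'_def Collect_conj_eq)
    \<comment> \<open>Orthogonal projection along \<open>e\<close>: the sign \<open>b e e\<close> is
      its own inverse.\<close>
    have dec: "x - (b e e * b e x) *\<^sub>R e \<in> T'" if "x \<in> T" for x
      using that eT ee less.prems(1) by (auto simp: T'_def bs intro!: subspace_diff subspace_scale)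
    have nd: "nondegenerate_on b T'"
      unfolding nondegenerate_on_def
    proof (intro ballI impI)
      fix w assume w: "w \<in> T'" "\<forall>w'\<in>T'. b w w' = 0"
      have "b w x = 0" if "x \<in> T" for x
        using w(2) dec[OF that] w(1) sym[of w e] by (auto simp: bs T'_def)
      then show "w = 0" using less.prems(2) w(1) unfolding nondegenerate_on_def T'_def by blast
    qed
    have "e \<notin> T'" using ee by (auto simp: T'_def)
    then have "T' \<subset> T" using eT T'_def by blast
    then have "dim T' < dim T"
      using dim_psubset[of T' T] T' less.prems(1) by (metis span_eq_iff)
    from less.hyps[OF this T' nd] obtain E where E: "orthonormal_basis_of b T' E" by blast
    have ET: "E \<subseteq> T'" and spE: "span E = T'" using E by (auto simp: orthonormal_basis_of_def)
    have "span (insert e E) = T"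
    proof
      show "span (insert e E) \<subseteq> T"
        using span_minimal[of "insert e E" T] eT ET less.prems(1) by (auto simp: T'_def)
      show "T \<subseteq> span (insert e E)"
        using dec by (auto simp: span_insert spE)
    qed
    moreover have "b e w = 0" "b w e = 0" if "w \<in> E" for w
      using that ET sym by (auto simp: T'_def)
    ultimately have "orthonormal_basis_of b T (insert e E)"
      using E ee eT ET unfolding orthonormal_basis_of_def T'_def by auto
    then show ?thesis ..
  qed
qed

section \<open>Orthonormal expansions and traces\<close>

lemma bilinear_sum_scale_left:
  assumes "bilinear b"
  shows "b (\<Sum>i\<in>A. c i *\<^sub>R i) y = (\<Sum>i\<in>A. c i * (b i y :: real))"
  using linear_sum[of "\<lambda>x. b x y" "\<lambda>i. c i *\<^sub>R i" A] linear_scale[of "\<lambda>x. b x y"] assms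
  by (simp add: bilinear_def)

lemma bilinear_sum_scale_right:
  assumes "bilinear b"
  shows "b y (\<Sum>i\<in>A. c i *\<^sub>R i) = (\<Sum>i\<in>A. c i * (b y i :: real))"
  using linear_sum[of "b y" "\<lambda>i. c i *\<^sub>R i" A] linear_scale[of "b y"] assms by (simp add: bilinear_def)

lemma orthonormal_basis_expand:
  fixes b :: "'v::real_vector \<Rightarrow> 'v \<Rightarrow> real"
  assumes b: "bilinear b" and E: "orthonormal_basis_of b T E" and "x \<in> T"
  shows "x = (\<Sum>e\<in>E. (b e e * b x e) *\<^sub>R e)"
proof -
  have fin: "finite E" using E by (simp add: orthonormal_basis_of_def)
  have "x \<in> span E" using E assms(3) by (simp add: orthonormal_basis_of_def)
  then obtain u where u: "x = (\<Sum>e\<in>E. u e *\<^sub>R e)" by (auto simp: span_finite[OF fin])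
  have "b x f = u f * b f f" if "f \<in> E" for f
  proof -
    have "b x f = (\<Sum>e\<in>E. u e * b e f)"
      by (simp add: u bilinear_sum_scale_left[OF b])
    also have "\<dots> = (\<Sum>e\<in>E. if e = f then u f * b f f else 0)"
      using E that by (intro sum.cong) (auto simp: orthonormal_basis_of_def)
    finally show ?thesis using that fin by simp
  qed
  moreover have "b f f * b f f = 1" if "f \<in> E" for f
    using E that by (auto simp: orthonormal_basis_of_def)
  ultimately have "(b e e * b x e) *\<^sub>R e = u e *\<^sub>R e" if "e \<in> E" for e
    using that by (metis mult.left_commute mult.right_neutral)
  then have "(\<Sum>e\<in>E. (b e e * b x e) *\<^sub>R e) = (\<Sum>e\<in>E. u e *\<^sub>R e)" by (rule sum.cong[OF refl])
  then show ?thesis using u by simp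
qed

text \<open>Expand every f in \<open>F\<close> over \<open>E\<close> in both arguments of \<beta>.
  The remaining sum over \<open>F\<close> is the expansion of an element of \<open>E\<close> over
  \<open>F\<close>, so it collapses to b(d, e), which is diagonal on \<open>E\<close>.\<close>

lemma orthonormal_trace_independent:
  fixes b \<beta> :: "'v::real_vector \<Rightarrow> 'v \<Rightarrow> real"
  assumes b: "bilinear b" and sym: "\<And>v w. b v w = b w v" and \<beta>: "bilinear \<beta>"
    and E: "orthonormal_basis_of b T E" and F: "orthonormal_basis_of b T F"
  shows "(\<Sum>f\<in>F. b f f * \<beta> f f) = (\<Sum>e\<in>E. b e e * \<beta> e e)"
proof -
  have fin: "finite E" "finite F" using E F by (auto simp: orthonormal_basis_of_def)
  have sub: "E \<subseteq> T" "F \<subseteq> T" using E F by (auto simp: orthonormal_basis_of_def)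
  have ex: "\<beta> f f = (\<Sum>d\<in>E. \<Sum>e\<in>E. (b d d * b f d) * ((b e e * b f e) * \<beta> d e))" if "f \<in> F" for f
  proof -
    have f: "f = (\<Sum>e\<in>E. (b e e * b f e) *\<^sub>R e)"
      using orthonormal_basis_expand[OF b E] that sub by blast
    have "\<beta> f f = \<beta> (\<Sum>d\<in>E. (b d d * b f d) *\<^sub>R d) (\<Sum>e\<in>E. (b e e * b f e) *\<^sub>R e)"
      using f by simp
    also have "\<dots> = (\<Sum>d\<in>E. (b d d * b f d) * (\<Sum>e\<in>E. (b e e * b f e) * \<beta> d e))"
      by (subst bilinear_sum_scale_left[OF \<beta>], subst bilinear_sum_scale_right[OF \<beta>]) (rule refl)
    finally show ?thesis by (simp only: sum_distrib_left)
  qed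
  have inner: "(\<Sum>f\<in>F. b f f * b f d * b f e) = b d e" if "d \<in> E" "e \<in> E" for d e
  proof -
    have d: "d = (\<Sum>f\<in>F. (b f f * b d f) *\<^sub>R f)"
      using orthonormal_basis_expand[OF b F] that sub by blast
    have "b d e = (\<Sum>f\<in>F. (b f f * b d f) * b f e)" by (subst d) (rule bilinear_sum_scale_left[OF b])
    then show ?thesis by (simp add: sym[of d])
  qed
  have "(\<Sum>f\<in>F. b f f * \<beta> f f)
      = (\<Sum>f\<in>F. \<Sum>d\<in>E. \<Sum>e\<in>E. (b d d * b e e * \<beta> d e) * (b f f * b f d * b f e))"
    by (rule sum.cong) (simp_all add: ex sum_distrib_left mult_ac)
  also have "\<dots> = (\<Sum>d\<in>E. \<Sum>e\<in>E. \<Sum>f\<in>F. (b d d * b e e * \<beta> d e) * (b f f * b f d * b f e))"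
    by (simp add: sum.swap[of _ F])
  also have "\<dots> = (\<Sum>d\<in>E. \<Sum>e\<in>E. (b d d * b e e * \<beta> d e) * b d e)"
    by (simp add: inner flip: sum_distrib_left)
  also have "\<dots> = (\<Sum>d\<in>E. \<Sum>e\<in>E. if d = e then b d d * \<beta> d d else 0)"
  proof (intro sum.cong refl)
    fix d e assume "d \<in> E" "e \<in> E"
    then have "b e e * b e e = 1" "d \<noteq> e \<Longrightarrow> b d e = 0"
      using E by (auto simp: orthonormal_basis_of_def)
    then show "(b d d * b e e * \<beta> d e) * b d e = (if d = e then b d d * \<beta> d d else 0)"
      by auto
  qed
  also have "\<dots> = (\<Sum>e\<in>E. b e e * \<beta> e e)" using fin by simp
  finally show ?thesis .
qed

text \<open>\<open>B\<close> is vector valued and controlled only on the diagonal of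
  \<open>T\<close>. Writing it there as a globally bilinear scalar form times a fixed n reduces the
  choice of basis to the scalar trace.\<close>

lemma metric_trace_eq:
  assumes "bilinear b" "\<And>v w. b v w = b w v" "bilinear \<beta>"
    and E: "orthonormal_basis_of b T E" and B: "\<And>e. e \<in> T \<Longrightarrow> B e e = \<beta> e e *\<^sub>R n"
  shows "metric_trace b T B = (\<Sum>e\<in>E. b e e * \<beta> e e) *\<^sub>R n"
proof -
  have *: "(\<Sum>e\<in>F. b e e *\<^sub>R B e e) = (\<Sum>e\<in>E. b e e * \<beta> e e) *\<^sub>R n"
    if F: "orthonormal_basis_of b T F" for F
  proof -
    have "(\<Sum>e\<in>F. b e e *\<^sub>R B e e) = (\<Sum>e\<in>F. (b e e * \<beta> e e) *\<^sub>R n)"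
      using F B by (intro sum.cong) (auto simp: orthonormal_basis_of_def)
    then show ?thesis
      using orthonormal_trace_independent[OF assms(1-3) E F] by (simp flip: scaleR_sum_left)
  qed
  show ?thesis unfolding metric_trace_def
    by (rule the_equality) (use E * in metis)+
qed

text \<open>Since n is not null, every x is a multiple of n plus a vector of the hyperplane. A
  vector of the hyperplane that is orthogonal to the hyperplane is thus orthogonal to
  everything.\<close>

lemma nondegenerate_orthogonal:
  assumes b: "bilinear b" and sym: "\<And>v w. b v w = b w v" and nd: "nondegenerate_on b UNIV"
    and n: "b n n \<noteq> (0::real)"
  shows "nondegenerate_on b {w. b n w = 0}"
  unfolding nondegenerate_on_def
proof (intro ballI impI)
  fix d assume d: "d \<in> {w. b n w = 0}" "\<forall>w\<in>{w. b n w = 0}. b d w = 0"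
  have "b d x = 0" for x
  proof -
    have "b n (x - (b n x / b n n) *\<^sub>R n) = 0"
      using n by (simp add: bilinear_rsub[OF b] bilinear_rmul[OF b])
    then have "b d (x - (b n x / b n n) *\<^sub>R n) = 0" using d by blast
    then show ?thesis using d(1) sym[of d n] by (simp add: bilinear_rsub[OF b] bilinear_rmul[OF b])
  qed
  then show "d = 0" using nd unfolding nondegenerate_on_def by blast
qed

lemma normal_part_orthogonal:
  assumes b: "bilinear b" and sym: "\<And>v w. b v w = b w v" and nd: "nondegenerate_on b UNIV"
    and n: "b n n \<noteq> (0::real)"
  shows "normal_part b {w. b n w = 0} z = (b n z / b n n) *\<^sub>R n"
  unfolding normal_part_def
proof (rule the_equality)
  let ?m = "(b n z / b n n) *\<^sub>R n"
  show m: "(\<forall>w\<in>{w. b n w = 0}. b ?m w = 0) \<and> z - ?m \<in> {w. b n w = 0}"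
    using n by (auto simp: bilinear_rsub[OF b] bilinear_rmul[OF b] bilinear_lmul[OF b])
  fix m assume m': "(\<forall>w\<in>{w. b n w = 0}. b m w = 0) \<and> z - m \<in> {w. b n w = 0}"
  have "\<forall>w\<in>{w. b n w = 0}. b (m - ?m) w = 0" using m m' by (simp add: bilinear_lsub[OF b])
  moreover have "m - ?m \<in> {w. b n w = 0}" using m m' by (simp add: bilinear_rsub[OF b])
  ultimately have "m - ?m = 0"
    using nondegenerate_orthogonal[OF b sym nd n] unfolding nondegenerate_on_def by blast
  then show "m = ?m" by simp
qed

text \<open>A crude operator norm from the matrix entries. Applied to the difference of a metric at
  two points, it turns Lipschitz entries into a Lipschitz form.\<close>

lemma bilinear_components_bound:
  fixes B :: "'v::euclidean_space \<Rightarrow> 'v \<Rightarrow> real"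
  assumes "bilinear B"
  shows "\<bar>B v w\<bar> \<le> (\<Sum>b\<in>Basis. \<Sum>c\<in>Basis. \<bar>B b c\<bar>) * norm v * norm w"
proof -
  have "B v w = (\<Sum>b\<in>Basis. \<Sum>c\<in>Basis. (v \<bullet> b) * ((w \<bullet> c) * B b c))"
  proof -
    have "B v w = B (\<Sum>b\<in>Basis. (v \<bullet> b) *\<^sub>R b) (\<Sum>c\<in>Basis. (w \<bullet> c) *\<^sub>R c)"
      by (simp add: euclidean_representation)
    also have "\<dots> = (\<Sum>b\<in>Basis. (v \<bullet> b) * (\<Sum>c\<in>Basis. (w \<bullet> c) * B b c))"
      by (subst bilinear_sum_scale_left[OF assms], subst bilinear_sum_scale_right[OF assms]) (rule refl)
    finally show ?thesis by (simp only: sum_distrib_left)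
  qed
  also have "\<bar>\<dots>\<bar> \<le> (\<Sum>b\<in>Basis. \<Sum>c\<in>Basis. \<bar>(v \<bullet> b) * ((w \<bullet> c) * B b c)\<bar>)"
    by (intro order_trans[OF sum_abs] sum_mono sum_abs)
  also have "\<dots> \<le> (\<Sum>b\<in>Basis. \<Sum>c\<in>Basis. \<bar>B b c\<bar> * (norm v * norm w))"
  proof (intro sum_mono)
    fix b c :: 'v assume "b \<in> Basis" "c \<in> Basis"
    then have "\<bar>v \<bullet> b\<bar> * \<bar>w \<bullet> c\<bar> \<le> norm v * norm w" by (intro mult_mono Basis_le_norm) auto
    from mult_left_mono[OF this, of "\<bar>B b c\<bar>"]
    show "\<bar>(v \<bullet> b) * ((w \<bullet> c) * B b c)\<bar> \<le> \<bar>B b c\<bar> * (norm v * norm w)"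
      by (simp add: abs_mult mult_ac)
  qed
  finally show ?thesis by (simp add: sum_distrib_right mult.assoc)
qed

text \<open>Finite dimension upgrades injectivity of the component map to a lower bound;
  \<open>hess_unit_gradient\<close> uses it to bound a vector by its products with
  \<open>Basis\<close>.\<close>

lemma nondegenerate_bounded_below:
  fixes b :: "'v::euclidean_space \<Rightarrow> 'v \<Rightarrow> real"
  assumes b: "bilinear b" and nd: "nondegenerate_on b UNIV"
  shows "\<exists>\<kappa>>0. \<forall>d. \<kappa> * norm d \<le> (\<Sum>c\<in>Basis. \<bar>b d c\<bar>)"
proof -
  let ?A = "\<lambda>z. \<Sum>c\<in>Basis. b z c *\<^sub>R c"
  obtain \<kappa> where \<kappa>: "\<kappa> > 0" "\<And>d. \<kappa> * norm d \<le> norm (?A d)"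
    using linear_inj_bounded_below_pos[OF nondegenerate_components[OF b nd]] by blast
  have "norm (?A d) \<le> (\<Sum>c\<in>Basis. \<bar>b d c\<bar>)" for d
    by (rule order_trans[OF norm_sum]) simp
  then show ?thesis using \<kappa> order_trans by blast
qed


section \<open>Scalar differential equations\<close>

lemma open_real_neighbours:
  fixes x :: real
  assumes "open I" "x \<in> I"
  shows "\<exists>a\<in>I. \<exists>b\<in>I. a < x \<and> x < b"
proof -
  obtain d where d: "d > 0" "cball x d \<subseteq> I" using assms open_contains_cball by blast
  then have "x - d \<in> I" "x + d \<in> I" by (auto simp: subset_iff dist_real_def)
  then show ?thesis using d(1) by force
qed

lemma open_real_surround:
  fixes s s0 :: real
  assumes "open I" "s0 \<in> I" "s \<in> I"
  obtains a b where "a \<in> I" "b \<in> I" "a < s" "s < b" "a < s0" "s0 < b"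
proof -
  have "min s0 s \<in> I" "max s0 s \<in> I" using assms by (auto simp: min_def max_def)
  then obtain a b where "a \<in> I" "b \<in> I" "a < min s0 s" "max s0 s < b"
    using open_real_neighbours[OF assms(1)] by meson
  then show ?thesis using that by auto
qed

lemma antiderivative_on_interval:
  fixes q :: "real \<Rightarrow> real"
  assumes "open I" "is_interval I" "s0 \<in> I" "continuous_on I q"
  shows "\<exists>Q. Q s0 = c \<and> (\<forall>s\<in>I. (Q has_real_derivative q s) (at s))"
proof -
  have "((\<lambda>u. LBINT y=s0..u. q y) has_real_derivative q s) (at s)" if s: "s \<in> I" for s
  proof -
    obtain a b where ab: "a \<in> I" "b \<in> I" "a < s" "s < b" "a < s0" "s0 < b"
      using open_real_surround[OF assms(1,3) s] .
    then have "{a..b} \<subseteq> I" using assms(2) unfolding is_interval_1 by (meson atLeastAtMost_iff subsetI)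
    then have "continuous_on {a..b} q" using assms(4) continuous_on_subset by blast
    with ab have "((\<lambda>u. LBINT y=s0..u. q y) has_vector_derivative q s) (at s within {a..b})"
      by (intro interval_integral_FTC2) auto
    then show ?thesis
      using ab at_within_Icc_at[of a s b]
      by (simp add: has_real_derivative_iff_has_vector_derivative)
  qed
  note D = this
  have "((\<lambda>u. c + (LBINT y=s0..u. q y)) has_real_derivative q s) (at s)" if "s \<in> I" for s
    using D[OF that] by (auto intro!: derivative_eq_intros)
  then show ?thesis by (intro exI[of _ "\<lambda>u::real. c + (LBINT y=s0..u. q y)"]) auto
qed

text \<open>Integrating factor: with Q' = q, the product of d and exp(-Q) has derivative zero, so it
  keeps its value 0 from \<open>s0\<close>.\<close>

lemma linear_ode_zero:
  fixes d q :: "real \<Rightarrow> real"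
  assumes "open I" "is_interval I" "s0 \<in> I" "continuous_on I q"
    and d: "\<And>s. s \<in> I \<Longrightarrow> (d has_real_derivative q s * d s) (at s)" and "d s0 = 0" "s \<in> I"
  shows "d s = 0"
proof -
  obtain Q where Q: "\<And>s. s \<in> I \<Longrightarrow> (Q has_real_derivative q s) (at s)"
    using antiderivative_on_interval[OF assms(1-4)] by blast
  have "((\<lambda>s. d s * exp (- Q s)) has_real_derivative 0) (at s within I)" if "s \<in> I" for s
    by (rule has_field_derivative_at_within)
      (use d[OF that] Q[OF that] in \<open>auto intro!: derivative_eq_intros\<close>)
  then have "d s * exp (- Q s) = d s0 * exp (- Q s0)"
    using has_field_derivative_zero_constant[of I "\<lambda>s. d s * exp (- Q s)"] assms
    by (metis is_interval_convex)
  then show ?thesis using assms(6) by simp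
qed

lemma power_derivative_bound:
  fixes d :: "real \<Rightarrow> real"
  assumes S: "is_interval S" "s0 \<in> S" "s \<in> S" and "d s0 = 0"
    and d: "\<And>r. r \<in> S \<Longrightarrow> (d has_real_derivative d' r) (at r)"
    and bd: "\<And>r. r \<in> S \<Longrightarrow> \<bar>d' r\<bar> \<le> c * \<bar>r - s0\<bar> ^ n"
  shows "\<bar>d s\<bar> \<le> c * \<bar>s - s0\<bar> ^ Suc n / real (Suc n)"
proof -
  \<comment> \<open>The reflection \<open>\<sigma> = \<plusminus>1\<close> moves the case \<open>s < s0\<close> to the right of the origin.\<close>
  define \<sigma> :: real where "\<sigma> = (if s0 \<le> s then 1 else -1)"
  define l where "l = \<bar>s - s0\<bar>"
  have sl: "s = s0 + \<sigma> * l" and \<sigma>: "\<bar>\<sigma>\<bar> = 1" by (auto simp: \<sigma>_def l_def)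
  have inS: "s0 + \<sigma> * t \<in> S" if "0 \<le> t" "t \<le> l" for t
  proof (cases "s0 \<le> s")
    case True
    then show ?thesis
      using that mem_is_interval_1_I[OF S, of "s0 + t"] by (simp add: \<sigma>_def l_def)
  next
    case False
    then show ?thesis
      using that mem_is_interval_1_I[OF S(1,3,2), of "s0 - t"] by (simp add: \<sigma>_def l_def)
  qed
  have "\<tau> * d s \<le> c * l ^ Suc n / real (Suc n)" if \<tau>: "\<bar>\<tau>\<bar> = 1" for \<tau>
  proof -
    \<comment> \<open>The barrier has derivative c t^n, which dominates that of \<tau> d for either
      sign \<tau>, so \<open>?e\<close> grows from \<open>?e 0 = 0\<close>. The two signs together
      bound the absolute value.\<close>
    let ?e = "\<lambda>t. c * t ^ Suc n / real (Suc n) - \<tau> * d (s0 + \<sigma> * t)"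
    have "?e 0 \<le> ?e l"
    proof (rule DERIV_nonneg_imp_nondecreasing[where f="?e" and a=0 and b=l])
      show "0 \<le> l" by (simp add: l_def)
      fix t assume t: "0 \<le> t" "t \<le> l"
      have "((\<lambda>t. d (s0 + \<sigma> * t)) has_real_derivative d' (s0 + \<sigma> * t) * \<sigma>) (at t)"
        by (rule DERIV_chain'[where f="\<lambda>t. s0 + \<sigma> * t", OF _ d[OF inS[OF t]]])
          (auto intro!: derivative_eq_intros)
      moreover have "((\<lambda>t. c * t ^ Suc n / real (Suc n)) has_real_derivative c * t ^ n) (at t)"
        using DERIV_cdivide[OF DERIV_cmult[OF DERIV_pow[of "Suc n" t]], of c "real (Suc n)"]
        by (simp del: of_nat_Suc)
      ultimately have "(?e has_real_derivative c * t ^ n - \<tau> * (d' (s0 + \<sigma> * t) * \<sigma>)) (at t)"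
        by (intro DERIV_diff DERIV_cmult)
      moreover have "\<bar>\<tau> * (d' (s0 + \<sigma> * t) * \<sigma>)\<bar> \<le> c * t ^ n"
        using bd[OF inS[OF t]] \<sigma> \<tau> t by (simp add: abs_mult)
      ultimately show "\<exists>y. (?e has_real_derivative y) (at t) \<and> 0 \<le> y" by force
    qed
    then show ?thesis using assms(4) by (simp add: sl)
  qed
  from this[of 1] this[of "-1"] show ?thesis by (simp add: l_def)
qed

text \<open>Picard iteration on all of \<open>I\<close> at once. On a compact interval around
  \<open>s0\<close>, where k is bounded by some K, the n-th increment is at most C K^n |s -
  s0|^(n+1) / (n+1)!. The factorial makes the series converge whatever the length of the interval,
  which replaces a continuation of local solutions.\<close>

lemma lipschitz_ode_global_solution:
  fixes \<Psi> :: "real \<Rightarrow> real \<Rightarrow> real"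
  assumes I: "open I" "is_interval I" "s0 \<in> I"
    and cont: "\<And>\<theta>. continuous_on I \<theta> \<Longrightarrow> continuous_on I (\<lambda>s. \<Psi> s (\<theta> s))"
    and k: "continuous_on I k" and lip: "\<And>s x y. s \<in> I \<Longrightarrow> \<bar>\<Psi> s x - \<Psi> s y\<bar> \<le> k s * \<bar>x - y\<bar>"
  shows "\<exists>\<theta>. \<theta> s0 = x0 \<and> (\<forall>s\<in>I. (\<theta> has_real_derivative \<Psi> s (\<theta> s)) (at s))"
proof -
  \<comment> \<open>An antiderivative is unique only on \<open>I\<close>, so \<open>step\<close>
    selects one; its values outside \<open>I\<close> are arbitrary.\<close>
  define step where "step \<theta> = (SOME Q. Q s0 = x0 \<and> (\<forall>s\<in>I. (Q has_real_derivative \<Psi> s (\<theta> s)) (at s)))"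
    for \<theta>
  have step: "step \<theta> s0 = x0" "\<And>s. s \<in> I \<Longrightarrow> (step \<theta> has_real_derivative \<Psi> s (\<theta> s)) (at s)"
    if "continuous_on I \<theta>" for \<theta>
    using someI_ex[OF antiderivative_on_interval[OF I cont[OF that], of x0]]
    unfolding step_def by auto
  define \<theta> where "\<theta> n = (step ^^ n) (\<lambda>_. x0)" for n
  have \<theta>Suc: "\<theta> (Suc n) = step (\<theta> n)" for n by (simp add: \<theta>_def)
  have \<theta>cont: "continuous_on I (\<theta> n)" for n
  proof (induction n)
    case 0
    then show ?case by (simp add: \<theta>_def)
  next
    case (Suc n)
    then show ?case using step(2)[OF Suc]
      by (intro continuous_at_imp_continuous_on) (auto simp: \<theta>Suc intro: DERIV_isCont)
  qed
  have \<theta>0: "\<theta> n s0 = x0" for n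
    by (cases n) (use step(1)[OF \<theta>cont] in \<open>auto simp: \<theta>_def\<close>)
  define e where "e n s = \<theta> (Suc n) s - \<theta> n s" for n s
  \<comment> \<open>\<open>\<theta> 0\<close> is constant, so the first increment has derivative
    \<open>\<Psi> s x0\<close> rather than a difference. The first \<open>Suc n\<close> terms then
    telescope to \<open>\<Psi> s (\<theta> n s)\<close>.\<close>
  define e' where "e' n s = (case n of 0 \<Rightarrow> \<Psi> s x0 | Suc m \<Rightarrow> \<Psi> s (\<theta> n s) - \<Psi> s (\<theta> m s))" for n s
  have e: "(e n has_real_derivative e' n s) (at s)" if "s \<in> I" for n s
  proof (cases n)
    case 0
    have "\<theta> 0 = (\<lambda>_. x0)" by (simp add: \<theta>_def)
    then show ?thesis using step(2)[OF \<theta>cont[of 0] that] unfolding e_def e'_def 0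
      by (auto intro!: derivative_eq_intros simp: \<theta>Suc)
  next
    case (Suc m)
    then show ?thesis unfolding e_def e'_def
      using step(2)[OF \<theta>cont[of n] that] step(2)[OF \<theta>cont[of m] that]
      by (auto intro!: derivative_eq_intros simp: \<theta>Suc)
  qed
  have \<theta>sum: "(\<Sum>i<n. e i s) = \<theta> n s - x0" for n s
    by (induction n) (auto simp: e_def \<theta>_def)
  have e'sum: "(\<Sum>i<Suc n. e' i s) = \<Psi> s (\<theta> n s)" for n s
    by (induction n) (auto simp: e'_def \<theta>_def)
  \<comment> \<open>The limit is written with \<open>lim\<close> so that the solution is one
    function, independent of the interval [a, b] on which convergence is proved.\<close>
  have loc: "(\<lambda>n. \<theta> n s) \<longlonglongrightarrow> lim (\<lambda>n. \<theta> n s) \<and>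
      ((\<lambda>s. lim (\<lambda>n. \<theta> n s)) has_real_derivative \<Psi> s (lim (\<lambda>n. \<theta> n s))) (at s within {a..b})"
    if ab: "a \<in> I" "b \<in> I" "a \<le> s0" "s0 \<le> b" "a \<le> s" "s \<le> b" for a b s
  proof -
    have sub: "{a..b} \<subseteq> I" using ab I(2) unfolding is_interval_1 by (meson atLeastAtMost_iff subsetI)
    have bd: "\<exists>B. \<forall>r\<in>{a..b}. \<bar>q r\<bar> \<le> B" if "continuous_on I q" for q :: "real \<Rightarrow> real"
    proof -
      have "compact (q ` {a..b})"
        by (intro compact_continuous_image continuous_on_subset[OF that sub]) simp
      from compact_imp_bounded[OF this] show ?thesis by (simp add: bounded_iff)
    qed
    obtain K where K: "\<And>r. r \<in> {a..b} \<Longrightarrow> \<bar>k r\<bar> \<le> K" using bd[OF k] by blast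
    obtain C where C: "\<And>r. r \<in> {a..b} \<Longrightarrow> \<bar>\<Psi> r x0\<bar> \<le> C"
      using bd[OF cont[of "\<lambda>_. x0"]] continuous_on_const[of I x0] by blast
    note KC = K C
    have K0: "0 \<le> K" and C0: "0 \<le> C" using KC[of s0] ab by auto
    have es0: "e n s0 = 0" for n by (simp add: e_def \<theta>0)
    have eab: "(e n has_real_derivative e' n r) (at r)" if "r \<in> {a..b}" for n r
      using e sub that by blast
    \<comment> \<open>The two bounds feed each other: integrating the bound on \<open>e' n\<close>
      gives the one on \<open>e n\<close>, and the Lipschitz condition turns this into the bound on
      \<open>e' (Suc n)\<close>.\<close>
    have e'bd: "\<bar>e' n r\<bar> \<le> C * K ^ n / fact n * \<bar>r - s0\<bar> ^ n"
      and ebd: "\<bar>e n r\<bar> \<le> C * K ^ n / fact n * \<bar>r - s0\<bar> ^ Suc n / real (Suc n)"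
      if "r \<in> {a..b}" for n r
      using that
    proof (induction n arbitrary: r)
      case 0
      {
        case 1 then show ?case using KC by (simp add: e'_def)
      next
        case 2
        show ?case
          by (rule power_derivative_bound[OF is_interval_cc _ 2 es0 eab]) (use ab KC in \<open>auto simp: e'_def\<close>)
      }
    next
      case (Suc n)
      have *: "\<bar>e' (Suc n) r\<bar> \<le> C * K ^ Suc n / fact (Suc n) * \<bar>r - s0\<bar> ^ Suc n" if "r \<in> {a..b}" for r
      proof -
        have "\<bar>e' (Suc n) r\<bar> \<le> k r * \<bar>e n r\<bar>"
          using lip[of r] that sub by (auto simp: e'_def e_def)
        also have "\<dots> \<le> K * (C * K ^ n / fact n * \<bar>r - s0\<bar> ^ Suc n / real (Suc n))"
          using KC(1)[OF that] Suc.IH(2)[OF that] K0 by (intro mult_mono) auto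
        also have "\<dots> = C * K ^ Suc n / fact (Suc n) * \<bar>r - s0\<bar> ^ Suc n"
          by (simp add: field_simps)
        finally show ?thesis .
      qed
      {
        case 1 then show ?case using * by blast
      next
        case 2
        show ?case
          by (rule power_derivative_bound[OF is_interval_cc _ 2 es0 eab]) (use ab * in auto)
      }
    qed
    have "uniform_limit {a..b} (\<lambda>n r. \<Sum>i<n. e' i r) (\<lambda>r. \<Sum>i. e' i r) sequentially"
    proof (rule Weierstrass_m_test)
      show "norm (e' n r) \<le> C * ((K * (b - a)) ^ n / fact n)" if "r \<in> {a..b}" for n r
      proof -
        have "\<bar>e' n r\<bar> \<le> C * K ^ n / fact n * \<bar>r - s0\<bar> ^ n" by (rule e'bd[OF that])
        also have "\<dots> \<le> C * K ^ n / fact n * (b - a) ^ n"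
          using that ab C0 K0 by (intro mult_left_mono power_mono) auto
        finally show ?thesis by (simp add: power_mult_distrib)
      qed
      show "summable (\<lambda>n. C * ((K * (b - a)) ^ n / fact n))"
        using summable_exp[of "K * (b - a)"] by (intro summable_mult) (simp add: field_simps)
    qed
    note ul = this
    \<comment> \<open>Termwise differentiation: the derivatives converge uniformly, and the
      increments themselves are summed at \<open>s0\<close>, where they all vanish.\<close>
    have "\<exists>G. \<forall>r\<in>{a..b}. (\<lambda>n. e n r) sums G r \<and> (G has_field_derivative (\<Sum>i. e' i r)) (at r within {a..b})"
    proof (rule has_field_derivative_series[OF _ _ ul])
      show "(e n has_real_derivative e' n r) (at r within {a..b})" if "r \<in> {a..b}" for n r
        using eab[OF that] by (rule has_field_derivative_at_within)
      show "s0 \<in> {a..b}" "summable (\<lambda>n. e n s0)" using ab by (auto simp: es0)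
    qed simp
    then obtain G where G: "\<And>r. r \<in> {a..b} \<Longrightarrow> (\<lambda>n. e n r) sums G r"
      "\<And>r. r \<in> {a..b} \<Longrightarrow> (G has_field_derivative (\<Sum>i. e' i r)) (at r within {a..b})" by blast
    have lim\<theta>: "(\<lambda>n. \<theta> n r) \<longlonglongrightarrow> x0 + G r" if "r \<in> {a..b}" for r
      using tendsto_add[OF tendsto_const[of x0] G(1)[OF that, unfolded sums_def]] by (simp add: \<theta>sum)
    have lim\<theta>eq: "lim (\<lambda>n. \<theta> n r) = x0 + G r" if "r \<in> {a..b}" for r
      using lim\<theta>[OF that] limI by blast
    have "(\<Sum>i. e' i s) = \<Psi> s (x0 + G s)"
    proof -
      have "(\<lambda>n. \<Sum>i<Suc n. e' i s) \<longlonglongrightarrow> (\<Sum>i. e' i s)"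
        using tendsto_uniform_limitI[OF ul, of s] ab by (subst filterlim_sequentially_Suc) auto
      moreover have "(\<lambda>n. \<Psi> s (\<theta> n s)) \<longlonglongrightarrow> \<Psi> s (x0 + G s)"
      proof -
        have "(\<lambda>n. k s * \<bar>\<theta> n s - (x0 + G s)\<bar>) \<longlonglongrightarrow> 0"
          using lim\<theta>[of s] ab LIM_zero[of "\<lambda>n. \<theta> n s"]
          by (auto intro!: tendsto_mult_right_zero tendsto_rabs_zero)
        then show ?thesis
          by (rule LIM_zero_cancel[OF Lim_null_comparison[rotated]])
            (use lip sub ab in auto)
      qed
      ultimately show ?thesis unfolding e'sum using LIMSEQ_unique by blast
    qed
    then have "((\<lambda>r. x0 + G r) has_real_derivative \<Psi> s (lim (\<lambda>n. \<theta> n s))) (at s within {a..b})"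
      using DERIV_add[OF DERIV_const[of x0] G(2)[of s]] lim\<theta>eq[of s] ab by simp
    then have "((\<lambda>r. lim (\<lambda>n. \<theta> n r)) has_real_derivative \<Psi> s (lim (\<lambda>n. \<theta> n s))) (at s within {a..b})"
      by (rule has_field_derivative_transform_within[OF _ zero_less_one]) (use ab lim\<theta>eq in auto)
    moreover have "(\<lambda>n. \<theta> n s) \<longlonglongrightarrow> lim (\<lambda>n. \<theta> n s)"
      using lim\<theta>[of s] lim\<theta>eq[of s] ab by simp
    ultimately show ?thesis by blast
  qed
  show ?thesis
  proof (intro exI conjI ballI)
    show "lim (\<lambda>n. \<theta> n s0) = x0" by (simp add: \<theta>0 lim_const)
    fix s assume s: "s \<in> I"
    obtain a b where "a \<in> I" "b \<in> I" "a < s" "s < b" "a < s0" "s0 < b"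
      using open_real_surround[OF I(1,3) s] .
    then show "((\<lambda>s. lim (\<lambda>n. \<theta> n s)) has_real_derivative \<Psi> s (lim (\<lambda>n. \<theta> n s))) (at s)"
      using loc[of a b s] at_within_Icc_at[of a s b] by simp
  qed
qed

section \<open>Level sets in a chart\<close>

lemma level_set_curve:
  fixes \<rho> :: "'v::euclidean_space \<Rightarrow> real"
  assumes U: "open U" "p \<in> U" and \<rho>: "smooth_on U \<rho>"
    and n: "frechet_derivative \<rho> (at p) n \<noteq> 0" and v: "frechet_derivative \<rho> (at p) v = 0"
  shows "\<exists>\<gamma>. \<gamma> 0 = p \<and> (\<forall>\<^sub>F t in nhds 0. \<gamma> t \<in> U \<and> \<rho> (\<gamma> t) = \<rho> p) \<and>
    (\<gamma> has_vector_derivative v) (at 0)"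
proof -
  \<comment> \<open>The map \<open>\<psi>\<close> straightens \<open>\<rho>\<close>: it satisfies \<open>L \<circ> \<psi> = \<rho>\<close> with \<open>L = d\<rho>(p)\<close>, and \<open>d\<psi>(p) = id\<close>.\<close>
  define L where "L = frechet_derivative \<rho> (at p)"
  define m where "m = (1 / L n) *\<^sub>R n"
  define \<psi> where "\<psi> x = x + (\<rho> x - L x) *\<^sub>R m" for x
  define \<psi>' where "\<psi>' x w = w + (frechet_derivative \<rho> (at x) w - L w) *\<^sub>R m" for x w
  have L: "(\<rho> has_derivative L) (at p)" using smooth_on_has_derivative[OF \<rho> U(2)] by (simp add: L_def)
  have Lb: "bounded_linear L" by (rule has_derivative_bounded_linear[OF L])
  have Lm: "L m = 1" using n bounded_linear.linear[OF Lb] by (simp add: m_def linear_scale flip: L_def)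
  have d\<psi>: "(\<psi> has_derivative \<psi>' x) (at x)" if "x \<in> U" for x
    unfolding \<psi>_def \<psi>'_def
    by (auto intro!: derivative_eq_intros smooth_on_has_derivative[OF \<rho> that]
        bounded_linear_imp_has_derivative[OF Lb])
  have bl: "bounded_linear (\<psi>' x)" if "x \<in> U" for x
    using d\<psi>[OF that] by (rule has_derivative_bounded_linear)
  have app: "blinfun_apply (Blinfun (\<psi>' x)) = \<psi>' x" if "x \<in> U" for x
    using bl[OF that] by (rule bounded_linear_Blinfun_apply)
  have cont: "continuous_on U (\<lambda>x. Blinfun (\<psi>' x))"
  proof (rule continuous_on_blinfun_componentwise)
    fix c :: 'v
    have "continuous_on U (\<lambda>x. \<psi>' x c)"
      unfolding \<psi>'_def by (intro continuous_intros smooth_on_continuous_on smooth_on_frechet \<rho>)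
    then show "continuous_on U (\<lambda>x. blinfun_apply (Blinfun (\<psi>' x)) c)"
      by (simp add: app cong: continuous_on_cong)
  qed
  have id: "\<psi>' p = (\<lambda>w. w)" by (auto simp: \<psi>'_def L_def)
  have inv: "id_blinfun o\<^sub>L Blinfun (\<psi>' p) = id_blinfun"
  proof (rule blinfun_eqI)
    fix w
    show "blinfun_apply (id_blinfun o\<^sub>L Blinfun (\<psi>' p)) w = blinfun_apply id_blinfun w"
      unfolding blinfun_apply_blinfun_compose app[OF U(2)] by (simp add: id)
  qed
  have d\<psi>': "(\<psi> has_derivative blinfun_apply (Blinfun (\<psi>' x))) (at x)" if "x \<in> U" for x
    using d\<psi>[OF that] by (simp add: app[OF that])
  obtain U' V g g' where UV: "open U'" "U' \<subseteq> U" "p \<in> U'" "open V" "\<psi> p \<in> V" "homeomorphism U' V \<psi> g"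
    and g: "\<And>y. y \<in> V \<Longrightarrow> (g has_derivative g' y) (at y)"
      "\<And>y. y \<in> V \<Longrightarrow> g' y = inv_into UNIV (blinfun_apply (Blinfun (\<psi>' (g y))))"
      "\<And>y. y \<in> V \<Longrightarrow> bij (blinfun_apply (Blinfun (\<psi>' (g y))))"
  proof -
    show thesis
      by (rule inverse_function_theorem[OF U(1) d\<psi>' cont U(2) inv], assumption) (rule that)
  qed
  have gp: "g (\<psi> p) = p" using UV by (simp add: homeomorphism_def)
  have g'p: "g' (\<psi> p) = (\<lambda>w. w)"
    unfolding g(2)[OF UV(5)] gp app[OF U(2)] unfolding id by (simp add: inv_id[unfolded id_def])
  have L\<psi>: "L (\<psi> x) = \<rho> x" for x
    using bounded_linear.linear[OF Lb] Lm by (simp add: \<psi>_def linear_add linear_scale)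
  \<comment> \<open>The pullback of a straight line by the local inverse: L is constant on the line
    because L v = 0, so \<rho> is constant along \<gamma>, and the identity derivative of g at
    \<psi> p preserves the velocity v.\<close>
  define \<gamma> where "\<gamma> t = g (\<psi> p + t *\<^sub>R v)" for t :: real
  have ev: "\<forall>\<^sub>F t in nhds 0. \<psi> p + t *\<^sub>R v \<in> V"
  proof -
    have "((\<lambda>t::real. \<psi> p + t *\<^sub>R v) \<longlongrightarrow> \<psi> p + 0 *\<^sub>R v) (nhds 0)"
      by (intro tendsto_intros filterlim_ident)
    then show ?thesis using UV(4,5) by (auto dest: topological_tendstoD)
  qed
  show ?thesis
  proof (intro exI[of _ \<gamma>] conjI)
    show "\<gamma> 0 = p" by (simp add: \<gamma>_def gp)
    show "\<forall>\<^sub>F t in nhds 0. \<gamma> t \<in> U \<and> \<rho> (\<gamma> t) = \<rho> p"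
      using ev
    proof eventually_elim
      case (elim t)
      then have "\<gamma> t \<in> U'" "\<psi> (\<gamma> t) = \<psi> p + t *\<^sub>R v"
        using UV(6) by (auto simp: homeomorphism_def \<gamma>_def)
      moreover have "L (\<psi> p + t *\<^sub>R v) = L (\<psi> p)"
        using bounded_linear.linear[OF Lb] v by (simp add: linear_add linear_scale flip: L_def)
      ultimately show ?case using UV(2) L\<psi>[of "\<gamma> t"] L\<psi>[of p] by auto
    qed
    have "((\<lambda>t. \<psi> p + t *\<^sub>R v) has_derivative (\<lambda>t. t *\<^sub>R v)) (at 0)"
      by (auto intro!: derivative_eq_intros)
    from has_derivative_compose[OF this, of g "g' (\<psi> p)"] g(1)[OF UV(5)]
    show "(\<gamma> has_vector_derivative v) (at 0)"
      by (simp add: has_vector_derivative_def \<gamma>_def[abs_def] g'p)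
  qed
qed

text \<open>Besides characterizing tangent vectors, this differentiates any function that vanishes
  along a curve in the hypersurface, such as d\<rho>(Y) for a tangent field Y.\<close>

lemma level_set_velocity:
  fixes \<rho> :: "'v::real_normed_vector \<Rightarrow> real"
  assumes "(\<rho> has_derivative L) (at (\<gamma> 0))" "(\<gamma> has_vector_derivative v) (at 0)"
    and "\<forall>\<^sub>F t in nhds 0. \<rho> (\<gamma> t) = c"
  shows "L v = 0"
proof -
  have "((\<lambda>t. \<rho> (\<gamma> t)) has_derivative (\<lambda>t. L (t *\<^sub>R v))) (at 0)"
    using has_derivative_compose[OF assms(2)[unfolded has_vector_derivative_def] assms(1)] .
  moreover have "((\<lambda>t. \<rho> (\<gamma> t)) has_derivative (\<lambda>_. 0)) (at 0)"
  proof (rule has_derivative_transform_eventually)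
    show "((\<lambda>_. c) has_derivative (\<lambda>_. 0)) (at (0::real))" by simp
    show "\<forall>\<^sub>F t in at 0. c = \<rho> (\<gamma> t)"
      using assms(3) unfolding eventually_nhds_conv_at by (auto elim: eventually_mono)
    show "c = \<rho> (\<gamma> 0)" using assms(3) by (auto dest: eventually_nhds_x_imp_x)
  qed simp
  ultimately have "(\<lambda>t. L (t *\<^sub>R v)) = (\<lambda>_. 0)" by (rule has_derivative_unique)
  from fun_cong[OF this, of 1] show ?thesis by simp
qed

section \<open>Second derivatives, Koszul terms and the coordinate Hessian\<close>

lemma frechet_derivative_plus:
  assumes "f differentiable (at x)" "g differentiable (at x)"
  shows "frechet_derivative (\<lambda>z. f z + g z) (at x) = (\<lambda>v. frechet_derivative f (at x) v + frechet_derivative g (at x) v)"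
  using assms by (intro frechet_derivative_eqI has_derivative_add has_derivative_frechet)

lemma frechet_derivative_scaleR:
  assumes "f differentiable (at x)"
  shows "frechet_derivative (\<lambda>z. r *\<^sub>R f z) (at x) = (\<lambda>v. r *\<^sub>R frechet_derivative f (at x) v)"
  using assms by (intro frechet_derivative_eqI has_derivative_scaleR_right has_derivative_frechet)

lemma frechet_derivative_mult_left:
  fixes f :: "_ \<Rightarrow> real"
  assumes "f differentiable (at x)"
  shows "frechet_derivative (\<lambda>z. r * f z) (at x) = (\<lambda>v. r * frechet_derivative f (at x) v)"
  using frechet_derivative_scaleR[OF assms, of r] by simp

lemma bilinear_frechet_second:
  assumes U: "open U" "y \<in> U" and \<rho>: "smooth_on U \<rho>"
  shows "bilinear (\<lambda>u v. frechet_derivative (\<lambda>z. frechet_derivative \<rho> (at z) v) (at y) u)"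
proof -
  let ?D = "\<lambda>v z. frechet_derivative \<rho> (at z) v"
  have d: "?D v differentiable (at y)" for v
    using smooth_on_differentiable[OF smooth_on_frechet[OF \<rho>] U(2)] .
  have lin: "linear (frechet_derivative \<rho> (at z))" if "z \<in> U" for z
    using linear_frechet_derivative[OF smooth_on_differentiable[OF \<rho> that]] .
  have "frechet_derivative (?D (v + w)) (at y) = frechet_derivative (\<lambda>z. ?D v z + ?D w z) (at y)" for v w
    by (rule frechet_derivative_transform_within_open[OF _ U]) (simp_all add: linear_add[OF lin] d)
  moreover have "frechet_derivative (?D (r *\<^sub>R v)) (at y) = frechet_derivative (\<lambda>z. r *\<^sub>R ?D v z) (at y)" for r v
    by (rule frechet_derivative_transform_within_open[OF _ U]) (simp_all add: linear_scale[OF lin] d)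
  ultimately show ?thesis
    by (simp add: bilinear_def frechet_derivative_plus d frechet_derivative_scaleR linear_iff
        linear_add[OF linear_frechet_derivative[OF d]] linear_scale[OF linear_frechet_derivative[OF d]])
qed

text \<open>The right-hand side of the Koszul formula for constant fields, i.e. the metric product
  of \<Gamma>(u, v) with w. As an expression in derivatives of the metric it can be computed for a
  product without solving for \<Gamma>.\<close>

definition koszul :: "('v::real_normed_vector \<Rightarrow> 'v \<Rightarrow> 'v \<Rightarrow> real) \<Rightarrow> 'v \<Rightarrow> 'v \<Rightarrow> 'v \<Rightarrow> 'v \<Rightarrow> real" where
  "koszul G y u v w = (frechet_derivative (\<lambda>z. G z v w) (at y) u + frechet_derivative (\<lambda>z. G z u w) (at y) v
     - frechet_derivative (\<lambda>z. G z u v) (at y) w) / 2"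

text \<open>This is the Hessian of \<open>\<rho>\<close> at \<open>y\<close> when \<open>n\<close> is the gradient: then \<open>koszul G y u v n\<close> is
  \<open>d\<rho>(\<Gamma>(u, v))\<close>.\<close>

definition hess :: "('v::real_normed_vector \<Rightarrow> 'v \<Rightarrow> 'v \<Rightarrow> real) \<Rightarrow> ('v \<Rightarrow> real) \<Rightarrow> 'v \<Rightarrow> 'v \<Rightarrow> 'v \<Rightarrow> 'v \<Rightarrow> real" where
  "hess G \<rho> n y u v = frechet_derivative (\<lambda>z. frechet_derivative \<rho> (at z) v) (at y) u - koszul G y u v n"

definition metric_form_on :: "'v::real_normed_vector set \<Rightarrow> ('v \<Rightarrow> 'v \<Rightarrow> 'v \<Rightarrow> real) \<Rightarrow> bool" where
  "metric_form_on U G \<longleftrightarrow>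
     (\<forall>y\<in>U. bilinear (G y) \<and> (\<forall>v w. G y v w = G y w v) \<and> nondegenerate_on (G y) UNIV) \<and>
     (\<forall>v w. smooth_on U (\<lambda>y. G y v w))"

text \<open>Linearity in w is what the Riesz argument for \<open>christoffel\<close> asks for;
  linearity in u and v makes the Hessian bilinear, so that its trace is well defined.\<close>

lemma koszul_linear:
  fixes G :: "'v::real_normed_vector \<Rightarrow> 'v \<Rightarrow> 'v \<Rightarrow> real"
  assumes U: "open U" "y \<in> U" and G: "metric_form_on U G"
  shows "linear (\<lambda>w. koszul G y u v w)" "linear (\<lambda>v. koszul G y u v w)" "linear (\<lambda>u. koszul G y u v w)"
proof -
  have bil: "bilinear (G z)" if "z \<in> U" for z using G that by (simp add: metric_form_on_def)
  have d: "(\<lambda>z. G z v w) differentiable (at y)" for v w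
    by (rule smooth_on_differentiable[OF _ U(2)]) (use G in \<open>simp add: metric_form_on_def\<close>)
  have "frechet_derivative (\<lambda>z. G z (v + v') w) (at y) = frechet_derivative (\<lambda>z. G z v w + G z v' w) (at y)" for v v' w
    by (rule frechet_derivative_transform_within_open[OF _ U]) (simp_all add: bilinear_ladd[OF bil] d)
  moreover have "frechet_derivative (\<lambda>z. G z (r *\<^sub>R v) w) (at y) = frechet_derivative (\<lambda>z. r *\<^sub>R G z v w) (at y)" for r v w
    by (rule frechet_derivative_transform_within_open[OF _ U]) (simp_all add: bilinear_lmul[OF bil] d)
  moreover have "frechet_derivative (\<lambda>z. G z w (v + v')) (at y) = frechet_derivative (\<lambda>z. G z w v + G z w v') (at y)" for v v' w
    by (rule frechet_derivative_transform_within_open[OF _ U]) (simp_all add: bilinear_radd[OF bil] d)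
  moreover have "frechet_derivative (\<lambda>z. G z w (r *\<^sub>R v)) (at y) = frechet_derivative (\<lambda>z. r *\<^sub>R G z w v) (at y)" for r v w
    by (rule frechet_derivative_transform_within_open[OF _ U]) (simp_all add: bilinear_rmul[OF bil] d)
  ultimately show "linear (\<lambda>w. koszul G y u v w)" "linear (\<lambda>v. koszul G y u v w)" "linear (\<lambda>u. koszul G y u v w)"
    by (auto simp: koszul_def linear_iff frechet_derivative_plus frechet_derivative_mult_left d
        linear_add[OF linear_frechet_derivative[OF d]] linear_scale[OF linear_frechet_derivative[OF d]]
        field_simps)
qed

lemma christoffel_koszul:
  fixes g :: "('i, 'v::euclidean_space) metric_tensor"
  assumes U: "open U" "y \<in> U" and G: "metric_form_on U (g i)"
  shows "g i y (christoffel g i y u v) w = koszul (g i) y u v w"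
proof -
  have "\<exists>!z. \<forall>w. g i y z w = koszul (g i) y u v w"
    using bilinear_riesz[OF _ _ koszul_linear(1)[OF U G]] G U(2) by (simp add: metric_form_on_def)
  from theI'[OF this] show ?thesis
    unfolding christoffel_def Let_def koszul_def by blast
qed

lemma bilinear_hess:
  assumes U: "open U" "y \<in> U" and G: "metric_form_on U G" and \<rho>: "smooth_on U \<rho>"
  shows "bilinear (hess G \<rho> n y)"
  using bilinear_frechet_second[OF U \<rho>] koszul_linear(2,3)[OF U G]
  unfolding bilinear_def hess_def by (auto intro!: linear_compose_sub)

section \<open>Hypersurfaces given by one equation in a chart\<close>

locale injective_chart =
  fixes M :: "('p, 'i, 'v::euclidean_space) manifold" and i :: 'i
  assumes inj: "inj_on (chart M i) (cdom M i)"
begin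

lemma chart_in: "x \<in> cdom M i \<Longrightarrow> chart M i x \<in> crange M i"
  by (simp add: crange_def)

lemma param_chart: "x \<in> cdom M i \<Longrightarrow> param M i (chart M i x) = x"
  by (simp add: param_def inj)

lemma chart_param: "y \<in> crange M i \<Longrightarrow> param M i y \<in> cdom M i \<and> chart M i (param M i y) = y"
  unfolding crange_def param_def by (simp add: f_inv_into_f inv_into_into)

end

text \<open>Serves both the fibres, with \<rho> = \<pi> - s, and the graph, with \<rho> = t -
  F(\<pi>): in either case one equation covers the whole chart domain.\<close>

locale level_hypersurface = injective_chart M i
  for M :: "('p, 'i, 'v::euclidean_space) manifold" and g :: "('i, 'v) metric_tensor"
    and S :: "'p set" and i :: 'i +
  fixes \<rho> :: "'v \<Rightarrow> real"
  assumes op: "open (crange M i)"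
    and metric: "metric_form_on (crange M i) (g i)"
    and smooth: "smooth_on (crange M i) \<rho>"
    and regular: "\<And>y. y \<in> crange M i \<Longrightarrow> \<exists>n. frechet_derivative \<rho> (at y) n \<noteq> 0"
    and zero: "\<And>x. x \<in> cdom M i \<Longrightarrow> x \<in> S \<longleftrightarrow> \<rho> (chart M i x) = 0"
begin

text \<open>Velocities lie in the kernel by the chain rule; conversely
  \<open>level_set_curve\<close> realizes each kernel vector by a curve in the chart, which
  \<open>param\<close> lifts to the manifold.\<close>

lemma tangent_space_eq:
  assumes x: "x \<in> S" "x \<in> cdom M i"
  shows "tangent_space M S i x = {v. frechet_derivative \<rho> (at (chart M i x)) v = 0}"
proof (intro equalityI subsetI CollectI)
  fix v assume "v \<in> tangent_space M S i x"
  then obtain \<gamma> where \<gamma>: "\<gamma> 0 = x" "\<forall>\<^sub>F t in nhds 0. \<gamma> t \<in> S \<inter> cdom M i"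
    "((chart M i \<circ> \<gamma>) has_vector_derivative v) (at (0::real))"
    unfolding tangent_space_def by blast
  have "\<forall>\<^sub>F t in nhds 0. \<rho> ((chart M i \<circ> \<gamma>) t) = 0"
    using \<gamma>(2) by eventually_elim (use zero in auto)
  then show "frechet_derivative \<rho> (at (chart M i x)) v = 0"
    using level_set_velocity[OF _ \<gamma>(3)] smooth_on_has_derivative[OF smooth chart_in[OF x(2)]] \<gamma>(1)
    by (metis comp_apply)
next
  fix v assume "v \<in> {v. frechet_derivative \<rho> (at (chart M i x)) v = 0}"
  then have v: "frechet_derivative \<rho> (at (chart M i x)) v = 0" by simp
  obtain n where n: "frechet_derivative \<rho> (at (chart M i x)) n \<noteq> 0"
    using regular[OF chart_in[OF x(2)]] by blast
  obtain \<gamma> where \<gamma>: "\<gamma> 0 = chart M i x"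
      "\<forall>\<^sub>F t in nhds 0. \<gamma> t \<in> crange M i \<and> \<rho> (\<gamma> t) = \<rho> (chart M i x)"
      "(\<gamma> has_vector_derivative v) (at (0::real))"
    using level_set_curve[OF op chart_in[OF x(2)] smooth n v] by blast
  have \<rho>x: "\<rho> (chart M i x) = 0" using x zero by blast
  show "v \<in> tangent_space M S i x"
    unfolding tangent_space_def
  proof (intro CollectI exI[of _ "\<lambda>t. param M i (\<gamma> t)"] conjI)
    show "param M i (\<gamma> 0) = x" by (simp add: \<gamma>(1) param_chart[OF x(2)])
    show "\<forall>\<^sub>F t in nhds 0. param M i (\<gamma> t) \<in> S \<inter> cdom M i"
      using \<gamma>(2) by eventually_elim (use chart_param zero \<rho>x in auto)
    show "((chart M i \<circ> (\<lambda>t. param M i (\<gamma> t))) has_vector_derivative v) (at 0)"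
      unfolding has_vector_derivative_def
    proof (rule has_derivative_transform_eventually)
      show "(\<gamma> has_derivative (\<lambda>t. t *\<^sub>R v)) (at 0)" using \<gamma>(3) by (simp add: has_vector_derivative_def)
      show "\<forall>\<^sub>F t in at 0. \<gamma> t = (chart M i \<circ> (\<lambda>t. param M i (\<gamma> t))) t"
        using \<gamma>(2) unfolding eventually_nhds_conv_at by (auto elim!: eventually_mono simp: chart_param)
      show "\<gamma> 0 = (chart M i \<circ> (\<lambda>t. param M i (\<gamma> t))) 0"
        using chart_param[OF chart_in[OF x(2)]] by (simp add: \<gamma>(1))
    qed simp
  qed
qed

end

text \<open>\<open>n\<close> is the gradient at the single point \<open>p\<close>, a vector rather
  than a field; its nonzero square makes the tangent space nondegenerate.\<close>

locale level_hypersurface_point = level_hypersurface +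
  fixes p and n
  assumes p: "p \<in> S" "p \<in> cdom M i"
    and grad: "\<And>w. g i (chart M i p) n w = frechet_derivative \<rho> (at (chart M i p)) w"
    and nn: "g i (chart M i p) n n \<noteq> 0"
begin

abbreviation "y \<equiv> chart M i p"
abbreviation "b \<equiv> g i y"
abbreviation "T \<equiv> tangent_space M S i p"
abbreviation "H \<equiv> hess (g i) \<rho> n y"

lemma chart_p_in: "y \<in> crange M i" by (rule chart_in[OF p(2)])

lemma form_p: "bilinear b" "\<And>v w. b v w = b w v" "nondegenerate_on b UNIV"
  using metric chart_p_in unfolding metric_form_on_def by blast+

lemma T_eq: "T = {w. b n w = 0}"
  by (simp add: tangent_space_eq[OF p] grad)

lemma T_nondegenerate: "nondegenerate_on b T"
  unfolding T_eq by (rule nondegenerate_orthogonal[OF form_p nn])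

lemma T_subspace: "subspace T"
  unfolding T_eq by (rule subspace_orthogonal[OF form_p(1)])

lemma tangent_extension_exists:
  assumes "v \<in> T"
  shows "\<exists>Y. tangent_extension M S i p v Y"
proof -
  let ?d = "\<lambda>z w. frechet_derivative \<rho> (at z) w"
  define V where "V = {z \<in> crange M i. ?d z n \<noteq> 0}"
  have sd: "smooth_on (crange M i) (\<lambda>z. ?d z w)" for w by (rule smooth_on_frechet[OF smooth])
  have V: "open V"
    using continuous_open_preimage[OF smooth_on_continuous_on[OF sd[of n]] op open_Compl[OF closed_singleton[of 0]]]
    by (simp add: V_def vimage_def Int_def)
  have VU: "V \<subseteq> crange M i" by (auto simp: V_def)
  have nz: "?d z n \<noteq> 0" if "z \<in> V" for z using that by (simp add: V_def)
  \<comment> \<open>The constant field v is corrected along the constant vector n so that d\<rho>(Y)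
    = 0 throughout \<open>V\<close>. The correction is smooth where d\<rho>(n) is nonzero and
    vanishes at \<open>p\<close> because v is tangent.\<close>
  define Y where "Y z = v - (?d z v * inverse (?d z n)) *\<^sub>R n" for z
  have "smooth_on V Y"
    using smooth_on_subset[OF sd VU] nz unfolding smooth_on_def Y_def
    by (auto intro!: Ck_on_diff Ck_on_scaleR Ck_on_mult Ck_on_inverse Ck_on_const V)
  moreover have "y \<in> V" using nn chart_p_in by (simp add: V_def flip: grad)
  moreover have "Y y = v" using assms by (simp add: Y_def T_eq flip: grad)
  moreover have "Y (chart M i x) \<in> tangent_space M S i x"
    if x: "x \<in> S \<inter> cdom M i" "chart M i x \<in> V" for x
  proof -
    have "linear (?d (chart M i x))"
      using linear_frechet_derivative[OF smooth_on_differentiable[OF smooth]] x(1) chart_in by blast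
    then show ?thesis using x
      by (auto simp: tangent_space_eq Y_def V_def linear_diff linear_scale)
  qed
  ultimately show ?thesis
    unfolding tangent_extension_def using V VU by blast
qed

text \<open>Differentiating d\<rho>(Y) = 0 along a curve in \<open>S\<close> with velocity u gives
  D^2\<rho>(u, v) + d\<rho>(DY(u)) = 0, and the Christoffel term adds \<open>koszul\<close> with
  last argument n. The result depends on Y only through v, which makes the second fundamental form
  well defined.\<close>

lemma cov_deriv_normal:
  assumes Y: "tangent_extension M S i p v Y" and u: "u \<in> T"
  shows "b n (cov_deriv g i Y y u) = - H u v"
proof -
  let ?d = "\<lambda>z w. frechet_derivative \<rho> (at z) w"
  obtain V where V: "open V" "y \<in> V" "V \<subseteq> crange M i" "smooth_on V Y" and Yy: "Y y = v"
    and tan: "\<And>x. x \<in> S \<inter> cdom M i \<Longrightarrow> chart M i x \<in> V \<Longrightarrow> Y (chart M i x) \<in> tangent_space M S i x"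
    using Y unfolding tangent_extension_def by blast
  obtain \<gamma> where \<gamma>: "\<gamma> 0 = p" "\<forall>\<^sub>F t in nhds 0. \<gamma> t \<in> S \<inter> cdom M i"
    "((chart M i \<circ> \<gamma>) has_vector_derivative u) (at (0::real))"
    using u unfolding tangent_space_def by blast
  have sd: "smooth_on (crange M i) (\<lambda>z. ?d z w)" for w by (rule smooth_on_frechet[OF smooth])
  have dY: "(Y has_derivative frechet_derivative Y (at y)) (at y)"
    using smooth_on_has_derivative[OF V(4,2)] .
  have lin: "linear (?d z)" if "z \<in> crange M i" for z
    using linear_frechet_derivative[OF smooth_on_differentiable[OF smooth that]] .
  \<comment> \<open>d\<rho>(Y) in components, so that the product rule for real functions
    applies.\<close>
  let ?F = "\<lambda>z. \<Sum>c\<in>Basis. (Y z \<bullet> c) * ?d z c"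
  let ?F' = "\<lambda>w. \<Sum>c\<in>Basis. (Y y \<bullet> c) * frechet_derivative (\<lambda>z. ?d z c) (at y) w + (frechet_derivative Y (at y) w \<bullet> c) * ?d y c"
  have Fd: "?F z = ?d z (Y z)" if "z \<in> crange M i" for z
    using linear_eq_sum_Basis[OF lin[OF that], of "Y z"] by simp
  have "(?F has_derivative ?F') (at y)"
    by (intro has_derivative_sum has_derivative_mult has_derivative_inner_left dY
        smooth_on_has_derivative[OF sd chart_p_in])
  moreover have "(?F has_derivative ?F') (at ((chart M i \<circ> \<gamma>) 0))"
    using calculation by (simp add: \<gamma>(1))
  moreover have "\<forall>\<^sub>F t in nhds 0. ?F ((chart M i \<circ> \<gamma>) t) = 0"
  proof -
    have "isCont (chart M i \<circ> \<gamma>) 0"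
      using \<gamma>(3) has_vector_derivative_continuous by blast
    then have "\<forall>\<^sub>F t in nhds 0. (chart M i \<circ> \<gamma>) t \<in> V"
      using V(1,2) \<gamma>(1) unfolding continuous_at_open eventually_nhds by (metis comp_apply)
    with \<gamma>(2) show ?thesis
    proof eventually_elim
      case (elim t)
      then have "Y (chart M i (\<gamma> t)) \<in> tangent_space M S i (\<gamma> t)" using tan by simp
      then show ?case using elim Fd[of "chart M i (\<gamma> t)"] chart_in[of "\<gamma> t"]
        by (simp add: tangent_space_eq)
    qed
  qed
  ultimately have "?F' u = 0" using level_set_velocity[OF _ \<gamma>(3)] by blast
  moreover have "(\<Sum>c\<in>Basis. (Y y \<bullet> c) * frechet_derivative (\<lambda>z. ?d z c) (at y) u)
      = frechet_derivative (\<lambda>z. ?d z v) (at y) u"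
    using linear_eq_sum_Basis[of "\<lambda>v. frechet_derivative (\<lambda>z. ?d z v) (at y) u" v]
      bilinear_frechet_second[OF op chart_p_in smooth] by (simp add: bilinear_def Yy)
  moreover have "(\<Sum>c\<in>Basis. (frechet_derivative Y (at y) u \<bullet> c) * ?d y c) = ?d y (frechet_derivative Y (at y) u)"
    using linear_eq_sum_Basis[OF lin[OF chart_p_in], of "frechet_derivative Y (at y) u"] by simp
  ultimately have "frechet_derivative (\<lambda>z. ?d z v) (at y) u + ?d y (frechet_derivative Y (at y) u) = 0"
    by (simp add: sum.distrib)
  moreover have "b n (christoffel g i y u v) = koszul (g i) y u v n"
    using christoffel_koszul[of _ y g i, OF op chart_p_in metric] form_p(2) by simp
  ultimately show ?thesis
    unfolding cov_deriv_def Yy hess_def by (simp add: bilinear_radd[OF form_p(1)] grad)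
qed

lemma second_fundamental_form_eq:
  assumes "u \<in> T" "v \<in> T"
  shows "second_fundamental_form M g S i p u v = (- H u v / b n n) *\<^sub>R n"
proof -
  have "normal_part b T (cov_deriv g i Y y u) = (- H u v / b n n) *\<^sub>R n"
    if "tangent_extension M S i p v Y" for Y
    unfolding T_eq using normal_part_orthogonal[OF form_p nn] cov_deriv_normal[OF that assms(1)] by simp
  then show ?thesis
    unfolding second_fundamental_form_def using tangent_extension_exists[OF assms(2)]
    by (intro the_equality) auto
qed

lemma mean_curvature_vector_eq:
  assumes "orthonormal_basis_of b T E"
  shows "mean_curvature_vector M g S i p = (- (\<Sum>e\<in>E. b e e * H e e) / b n n) *\<^sub>R n"
proof -
  let ?\<beta> = "\<lambda>u v. - H u v / b n n"
  have "bilinear ?\<beta>"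
    using bilinear_hess[OF op chart_p_in metric smooth] unfolding bilinear_def linear_iff by (auto simp: add_divide_distrib diff_divide_distrib)
  from metric_trace_eq[OF form_p(1,2) this assms, of "second_fundamental_form M g S i p" n]
  show ?thesis
    unfolding mean_curvature_vector_def
    by (simp add: second_fundamental_form_eq sum_negf flip: sum_divide_distrib)
qed

end

section \<open>Functions with gradient of constant length\<close>

lemma differentiable_lipschitz_at:
  fixes f :: "'a::real_normed_vector \<Rightarrow> 'b::real_normed_vector"
  assumes "f differentiable (at y)"
  shows "\<exists>C\<ge>0. \<forall>\<^sub>F z in nhds y. norm (f z - f y) \<le> C * norm (z - y)"
proof -
  obtain f' where f': "(f has_derivative f') (at y)" using assms by (auto simp: differentiable_def)
  then obtain K where K: "\<And>h. norm (f' h) \<le> norm h * K" "K > 0"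
    using bounded_linear.pos_bounded[OF has_derivative_bounded_linear[OF f']] by blast
  obtain d where d: "d > 0" "\<And>z. norm (z - y) < d \<Longrightarrow> norm (f z - f y - f' (z - y)) \<le> 1 * norm (z - y)"
    using f' unfolding has_derivative_at_alt by (meson zero_less_one)
  have "norm (f z - f y) \<le> (K + 1) * norm (z - y)" if "dist z y < d" for z
  proof -
    have "norm (f z - f y) \<le> norm (f z - f y - f' (z - y)) + norm (f' (z - y))"
      using norm_triangle_ineq[of "f z - f y - f' (z - y)" "f' (z - y)"] by simp
    also have "\<dots> \<le> 1 * norm (z - y) + norm (z - y) * K"
      using d(2)[of z] K(1) that by (intro add_mono) (auto simp: dist_norm)
    finally show ?thesis by (simp add: algebra_simps)
  qed
  then have "\<forall>\<^sub>F z in nhds y. norm (f z - f y) \<le> (K + 1) * norm (z - y)"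
    unfolding eventually_nhds_metric using d(1) by blast
  then show ?thesis using K(2) by (intro exI[of _ "K + 1"]) auto
qed

lemma has_derivative_zero_quadratic:
  fixes f :: "'a::real_normed_vector \<Rightarrow> 'b::real_normed_vector"
  assumes "\<forall>\<^sub>F z in nhds y. norm (f z - f y) \<le> K * (norm (z - y))\<^sup>2"
  shows "(f has_derivative (\<lambda>_. 0)) (at y)"
proof -
  obtain d where d: "d > 0" "\<And>z. dist z y < d \<Longrightarrow> norm (f z - f y) \<le> K * (norm (z - y))\<^sup>2"
    using assms unfolding eventually_nhds_metric by blast
  show ?thesis
  proof (rule has_derivativeI_sandwich[OF d(1), where H="\<lambda>z. K * norm (z - y)"])
    show "norm (f z - f y - 0) / norm (z - y) \<le> K * norm (z - y)" if "z \<noteq> y" "dist z y < d" for z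
      using d(2)[OF that(2)] that(1) by (simp add: divide_le_eq power2_eq_square mult.assoc)
    have "((\<lambda>z. K * norm (z - y)) \<longlongrightarrow> K * norm (y - y)) (at y)" by (intro tendsto_intros)
    then show "((\<lambda>z. K * norm (z - y)) \<longlongrightarrow> 0) (at y)" by simp
  qed simp
qed

text \<open>The gradient field \<open>N\<close> is only known to be the solution of a linear system, so instead of
  differentiating \<open>N\<close> we use that \<open>2 d\<rho>\<^sub>z(k) - G\<^sub>z(k, k)\<close> is stationary in \<open>k\<close> at \<open>k = N z\<close>: for
  \<open>k = N y\<close> fixed it differs from the constant \<open>c\<close> by \<open>G\<^sub>z(k - N z, k - N z)\<close>, which is quadratic in
  \<open>z - y\<close>.\<close>

lemma hess_unit_gradient:
  fixes G :: "'v::euclidean_space \<Rightarrow> 'v \<Rightarrow> 'v \<Rightarrow> real"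
  assumes U: "open U" "y \<in> U" and G: "metric_form_on U G" and \<rho>: "smooth_on U \<rho>"
    and N: "\<And>z w. z \<in> U \<Longrightarrow> G z (N z) w = frechet_derivative \<rho> (at z) w"
    and unit: "\<And>z. z \<in> U \<Longrightarrow> G z (N z) (N z) = c"
  shows "hess G \<rho> (N y) y v (N y) = 0"
proof -
  define n where "n = N y"
  let ?d = "\<lambda>z w. frechet_derivative \<rho> (at z) w"
  have bil: "bilinear (G z)" and sym: "\<And>v w. G z v w = G z w v" and nd: "nondegenerate_on (G z) UNIV"
    if "z \<in> U" for z using G that by (auto simp: metric_form_on_def)
  have Gd: "(\<lambda>z. G z v w) differentiable (at y)" for v w
    by (rule smooth_on_differentiable[OF _ U(2)]) (use G in \<open>simp add: metric_form_on_def\<close>)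
  have dd: "(\<lambda>z. ?d z w) differentiable (at y)" for w
    using smooth_on_differentiable[OF smooth_on_frechet[OF \<rho>] U(2)] .
  have evU: "\<forall>\<^sub>F z in nhds y. z \<in> U" using U by (rule eventually_nhds_in_open)
  define \<delta>1 where "\<delta>1 z = (\<Sum>b\<in>Basis. \<Sum>c\<in>Basis. \<bar>G z b c - G y b c\<bar>)" for z
  define \<delta>2 where "\<delta>2 z = (\<Sum>b\<in>Basis. \<bar>?d z b - ?d y b\<bar>)" for z
  have sumbd: "\<exists>C\<ge>0. \<forall>\<^sub>F z in nhds y. (\<Sum>j\<in>A. F j z) \<le> C * norm (z - y)"
    if "finite A" "\<And>j. j \<in> A \<Longrightarrow> \<exists>C\<ge>0. \<forall>\<^sub>F z in nhds y. F j z \<le> C * norm (z - y)"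
    for A :: "'v set" and F :: "'v \<Rightarrow> 'v \<Rightarrow> real"
    using that
  proof (induction A rule: finite_induct)
    case (insert j A)
    obtain C where C: "C \<ge> 0" "\<forall>\<^sub>F z in nhds y. (\<Sum>j\<in>A. F j z) \<le> C * norm (z - y)"
      using insert by auto
    obtain D where D: "D \<ge> 0" "\<forall>\<^sub>F z in nhds y. F j z \<le> D * norm (z - y)"
      using insert by auto
    have "\<forall>\<^sub>F z in nhds y. (\<Sum>j\<in>insert j A. F j z) \<le> (C + D) * norm (z - y)"
      using C(2) D(2) by eventually_elim (use insert.hyps in \<open>simp add: algebra_simps\<close>)
    then show ?case using C(1) D(1) by (intro exI[of _ "C + D"]) auto
  qed (auto intro: exI[of _ 0])
  obtain C1 where C1: "C1 \<ge> 0" "\<forall>\<^sub>F z in nhds y. \<delta>1 z \<le> C1 * norm (z - y)"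
  proof -
    have "\<exists>C\<ge>0. \<forall>\<^sub>F z in nhds y. \<delta>1 z \<le> C * norm (z - y)"
      unfolding \<delta>1_def
      by (intro sumbd differentiable_lipschitz_at[OF Gd, unfolded real_norm_def]) auto
    then show ?thesis using that by blast
  qed
  obtain C2 where C2: "C2 \<ge> 0" "\<forall>\<^sub>F z in nhds y. \<delta>2 z \<le> C2 * norm (z - y)"
  proof -
    have "\<exists>C\<ge>0. \<forall>\<^sub>F z in nhds y. \<delta>2 z \<le> C * norm (z - y)"
      unfolding \<delta>2_def
      by (intro sumbd differentiable_lipschitz_at[OF dd, unfolded real_norm_def]) auto
    then show ?thesis using that by blast
  qed
  obtain \<kappa> where \<kappa>: "\<kappa> > 0" "\<And>d. \<kappa> * norm d \<le> (\<Sum>c\<in>Basis. \<bar>G y d c\<bar>)"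
    using nondegenerate_bounded_below[OF bil[OF U(2)] nd[OF U(2)]] by blast
  define m where "m = real DIM('v)"
  have m: "m > 0" by (simp add: m_def)
  define C where "C = C1 + C2"
  \<comment> \<open>Within this radius \<delta>1 + \<delta>2 is at most \<kappa> / (2 m), so the
    term with \<open>N z - n\<close> on the right of the estimate below is at most half of the left
    side and is absorbed; hence the factor 2 in \<open>L\<close>. The bound 1 serves the quadratic
    estimate of G at z.\<close>
  define e where "e = min 1 (\<kappa> / (2 * m)) / (C + 1)"
  have C0: "C \<ge> 0" using C1(1) C2(1) by (simp add: C_def)
  have e0: "e > 0" using \<kappa>(1) m C0 by (simp add: e_def)
  define L where "L = 2 * m * (norm n + 1) * C / \<kappa>"
  have diffG: "\<bar>G z v w - G y v w\<bar> \<le> \<delta>1 z * norm v * norm w" if "z \<in> U" for z v w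
  proof -
    have "bilinear (\<lambda>v w. G z v w - G y v w)"
      using bil[OF that] bil[OF U(2)] by (auto simp: bilinear_def intro: linear_compose_sub)
    from bilinear_components_bound[OF this] show ?thesis by (simp add: \<delta>1_def)
  qed
  have ball: "\<forall>\<^sub>F z in nhds y. dist z y < e" using e0 unfolding eventually_nhds_metric by blast
  have lipN: "\<forall>\<^sub>F z in nhds y. norm (N z - n) \<le> L * norm (z - y) \<and> \<delta>1 z \<le> 1"
    using evU C1(2) C2(2) ball
  proof eventually_elim
    case (elim z)
    let ?D = "N z - n"
    have nonneg: "\<delta>1 z \<ge> 0" "\<delta>2 z \<ge> 0" by (auto simp: \<delta>1_def \<delta>2_def intro!: sum_nonneg)
    have \<delta>C: "\<delta>1 z + \<delta>2 z \<le> C * norm (z - y)" using elim by (simp add: C_def algebra_simps)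
    also have "\<dots> \<le> (C + 1) * e" using elim C0 by (intro mult_mono) (auto simp: dist_norm)
    also have "\<dots> = min 1 (\<kappa> / (2 * m))" using C0 by (simp add: e_def)
    finally have \<delta>e: "\<delta>1 z + \<delta>2 z \<le> 1" "\<delta>1 z + \<delta>2 z \<le> \<kappa> / (2 * m)" by auto
    have "\<bar>G y ?D c\<bar> \<le> (\<delta>1 z + \<delta>2 z) * (norm n + norm ?D + 1)" if c: "c \<in> Basis" for c
    proof -
      \<comment> \<open>Subtracting the systems that define N z and n leaves changes of
        coefficients. One of them multiplies N z, which is bounded through n and \<open>?D\<close>,
        so \<open>?D\<close> reappears on the right.\<close>
      have "G y ?D c = - (G z (N z) c - G y (N z) c) + (?d z c - ?d y c)"
        using N[OF elim(1)] N[OF U(2)] by (simp add: bilinear_lsub[OF bil[OF U(2)]] n_def)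
      moreover have "\<bar>G z (N z) c - G y (N z) c\<bar> \<le> \<delta>1 z * norm (N z)"
        using diffG[OF elim(1), of "N z" c] c by simp
      moreover have "\<bar>?d z c - ?d y c\<bar> \<le> \<delta>2 z"
        unfolding \<delta>2_def using c by (intro member_le_sum) auto
      moreover have "\<delta>1 z * norm (N z) \<le> \<delta>1 z * (norm n + norm ?D)"
        using nonneg norm_triangle_ineq[of n ?D] by (intro mult_left_mono) auto
      moreover have "\<delta>1 z * (norm n + norm ?D) + \<delta>2 z \<le> (\<delta>1 z + \<delta>2 z) * (norm n + norm ?D + 1)"
        using nonneg by (simp add: algebra_simps)
      ultimately show ?thesis by linarith
    qed
    then have "(\<Sum>c\<in>Basis. \<bar>G y ?D c\<bar>) \<le> m * ((\<delta>1 z + \<delta>2 z) * (norm n + norm ?D + 1))"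
      unfolding m_def by (rule sum_bounded_above)
    with \<kappa>(2)[of ?D] have "\<kappa> * norm ?D \<le> m * (\<delta>1 z + \<delta>2 z) * (norm n + 1) + m * (\<delta>1 z + \<delta>2 z) * norm ?D"
      by (simp add: algebra_simps)
    moreover have "m * (\<delta>1 z + \<delta>2 z) * norm ?D \<le> \<kappa> / 2 * norm ?D"
      using \<delta>e(2) m by (intro mult_right_mono) (auto simp: field_simps)
    moreover have "m * (\<delta>1 z + \<delta>2 z) * (norm n + 1) \<le> m * (C * norm (z - y)) * (norm n + 1)"
      using \<delta>C m by (intro mult_right_mono mult_left_mono) auto
    ultimately have "\<kappa> / 2 * norm ?D \<le> m * (C * norm (z - y)) * (norm n + 1)" by linarith
    then have "norm ?D \<le> L * norm (z - y)"
      using \<kappa>(1) by (simp add: L_def field_simps)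
    then show ?case using \<delta>e(1) nonneg by simp
  qed
  define F where "F z = 2 * ?d z n - G z n n" for z
  define K where "K = (\<Sum>b\<in>Basis. \<Sum>c\<in>Basis. \<bar>G y b c\<bar>)"
  have K0: "K \<ge> 0" by (auto simp: K_def intro!: sum_nonneg)
  have Feq: "F z = c - G z (N z - n) (N z - n)" if "z \<in> U" for z
    using that unit[OF that] N[OF that, of n] sym[OF that, of n "N z"]
    by (simp add: F_def bilinear_lsub[OF bil] bilinear_rsub[OF bil])
  have Fy: "F y = c" using Feq[OF U(2)] bilinear_lzero[OF bil[OF U(2)]] by (simp add: n_def)
  have "\<forall>\<^sub>F z in nhds y. norm (F z - F y) \<le> ((K + 1) * L\<^sup>2) * (norm (z - y))\<^sup>2"
    using evU lipN
  proof eventually_elim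
    case (elim z)
    let ?D = "N z - n"
    have "\<bar>G z ?D ?D\<bar> \<le> \<bar>G y ?D ?D\<bar> + \<bar>G z ?D ?D - G y ?D ?D\<bar>" by linarith
    also have "\<dots> \<le> K * norm ?D * norm ?D + \<delta>1 z * norm ?D * norm ?D"
      using bilinear_components_bound[OF bil[OF U(2)], of ?D ?D] diffG[OF elim(1), of ?D ?D]
      by (simp add: K_def)
    also have "\<dots> = (K + \<delta>1 z) * (norm ?D)\<^sup>2" by (simp add: power2_eq_square algebra_simps)
    also have "\<dots> \<le> (K + 1) * (L * norm (z - y))\<^sup>2"
      using elim K0 by (intro mult_mono power_mono) auto
    finally show ?case using Feq[OF elim(1)] Fy by (simp add: power_mult_distrib mult.assoc)
  qed
  then have "(F has_derivative (\<lambda>_. 0)) (at y)" by (rule has_derivative_zero_quadratic)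
  moreover have "(F has_derivative (\<lambda>v. 2 * frechet_derivative (\<lambda>z. ?d z n) (at y) v
      - frechet_derivative (\<lambda>z. G z n n) (at y) v)) (at y)"
    unfolding F_def
    by (intro has_derivative_diff has_derivative_mult_right has_derivative_frechet dd Gd)
  ultimately have "(\<lambda>_. 0) = (\<lambda>v. 2 * frechet_derivative (\<lambda>z. ?d z n) (at y) v
      - frechet_derivative (\<lambda>z. G z n n) (at y) v)"
    by (rule has_derivative_unique)
  \<comment> \<open>In \<open>koszul G y v n n\<close> the last two terms cancel, leaving half the
    derivative of G(n, n) along v; the vanishing derivative of \<open>F\<close> is therefore twice
    the Hessian.\<close>
  from fun_cong[OF this, of v] show ?thesis by (simp add: hess_def koszul_def flip: n_def)
qed

lemma frechet_derivative_minus_const: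
  "frechet_derivative (\<lambda>y. f y - c) F = frechet_derivative f F"
proof -
  have "((\<lambda>y. f y - c) has_derivative D) F \<longleftrightarrow> (f has_derivative D) F" for D
    using has_derivative_diff[OF _ has_derivative_const, of f D F c]
      has_derivative_add[OF _ has_derivative_const, of "\<lambda>y. f y - c" D F c] by auto
  then show ?thesis by (simp add: frechet_derivative_def)
qed

lemma hess_minus_const: "hess G (\<lambda>y. \<rho> y - c) n y u v = hess G \<rho> n y u v"
  by (simp add: hess_def frechet_derivative_minus_const)

section \<open>The submersion and its fibres in one chart\<close>

locale unit_submersion_chart = injective_chart M i
  for M :: "('p, 'i, 'v::euclidean_space) manifold" and g :: "('i, 'v) metric_tensor"
    and \<pi> :: "'p \<Rightarrow> real" and i :: 'i and \<epsilon> :: real +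
  assumes i: "i \<in> idx M" and dom: "cdom M i \<subseteq> pts M" and op: "open (crange M i)"
    and metric: "metric_form_on (crange M i) (g i)"
    and smooth: "smooth_on (crange M i) (\<lambda>y. \<pi> (param M i y))"
    and unit: "\<And>x. x \<in> cdom M i \<Longrightarrow> g i (chart M i x) (gradient M g \<pi> i x) (gradient M g \<pi> i x) = \<epsilon>"
    and \<epsilon>: "\<epsilon> \<in> {1, -1}"
begin

abbreviation "u \<equiv> \<lambda>y. \<pi> (param M i y)"
abbreviation "n \<equiv> gradient M g \<pi> i"
abbreviation "du y v \<equiv> frechet_derivative u (at y) v"

lemma form:
  assumes "y \<in> crange M i"
  shows "bilinear (g i y)" "\<And>v w. g i y v w = g i y w v" "nondegenerate_on (g i y) UNIV"
  using metric assms by (auto simp: metric_form_on_def)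

lemma du_linear: "y \<in> crange M i \<Longrightarrow> linear (frechet_derivative u (at y))"
  using smooth smooth_on_differentiable linear_frechet_derivative by blast

lemma gradient: "x \<in> cdom M i \<Longrightarrow> g i (chart M i x) (n x) w = du (chart M i x) w"
  using theI'[OF bilinear_riesz[OF form(1,3) du_linear, of "chart M i x" "chart M i x"]] chart_in[of x]
  unfolding gradient_def comp_def by blast

lemma du_gradient: "x \<in> cdom M i \<Longrightarrow> du (chart M i x) (n x) = \<epsilon>"
  using unit gradient by metis

lemma hess_gradient:
  assumes "x \<in> cdom M i"
  shows "hess (g i) u (n x) (chart M i x) v (n x) = 0"
  using hess_unit_gradient[OF op chart_in[OF assms] metric smooth, of "\<lambda>z. n (param M i z)" \<epsilon> v]
    gradient unit chart_param param_chart[OF assms] by metis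

lemma fibre_point:
  assumes x: "x \<in> cdom M i" and s: "\<pi> x = s"
  shows "level_hypersurface_point M g {z \<in> pts M. \<pi> z = s} i (\<lambda>z. u z - s) x (n x)"
proof
  show "smooth_on (crange M i) (\<lambda>z. u z - s)"
    using smooth unfolding smooth_on_def by (auto intro!: Ck_on_diff Ck_on_const op)
  show "\<exists>n. frechet_derivative (\<lambda>z. u z - s) (at y) n \<noteq> 0" if "y \<in> crange M i" for y
    using du_gradient[of "param M i y"] chart_param[OF that] \<epsilon>
    by (intro exI[of _ "n (param M i y)"]) (auto simp: frechet_derivative_minus_const)
  show "x \<in> {z \<in> pts M. \<pi> z = s} \<longleftrightarrow> u (chart M i x) - s = 0" if "x \<in> cdom M i" for x
    using that dom by (auto simp: param_chart)
  show "g i (chart M i x) (n x) w = frechet_derivative (\<lambda>z. u z - s) (at (chart M i x)) w" for w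
    using gradient[OF x] by (simp add: frechet_derivative_minus_const)
  show "g i (chart M i x) (n x) (n x) \<noteq> 0" using unit[OF x] \<epsilon> by auto
qed (use inj op metric x s dom in auto)

text \<open>The level set formula gives the mean curvature vector -(tr/\<epsilon>) n, the convention
  with unit normal -n gives -\<epsilon> k n; since \<epsilon>^2 = 1 the signs cancel.\<close>

lemma fibre_hess_trace:
  assumes x: "x \<in> cdom M i" and s: "\<pi> x = s"
    and mc: "has_mean_curvature M g {z \<in> pts M. \<pi> z = s} (\<lambda>i x. - gradient M g \<pi> i x) (\<lambda>_. k)"
    and E: "orthonormal_basis_of (g i (chart M i x)) {v. du (chart M i x) v = 0} E"
  shows "(\<Sum>e\<in>E. g i (chart M i x) e e * hess (g i) u (n x) (chart M i x) e e) = k"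
proof -
  interpret level_hypersurface_point M g "{z \<in> pts M. \<pi> z = s}" i "\<lambda>z. u z - s" x "n x"
    by (rule fibre_point[OF x s])
  have T: "tangent_space M {z \<in> pts M. \<pi> z = s} i x = {v. du (chart M i x) v = 0}"
    unfolding T_eq by (simp add: gradient[OF x])
  let ?tr = "\<Sum>e\<in>E. g i (chart M i x) e e * hess (g i) u (n x) (chart M i x) e e"
  have "mean_curvature_vector M g {z \<in> pts M. \<pi> z = s} i x = (- ?tr / \<epsilon>) *\<^sub>R n x"
    using mean_curvature_vector_eq[of E] E unit[OF x] by (simp add: T hess_minus_const)
  moreover have "mean_curvature_vector M g {z \<in> pts M. \<pi> z = s} i x = (\<epsilon> * k) *\<^sub>R (- n x)"
    using mc x s dom i unit[OF x] form_p(1)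
    by (auto simp: has_mean_curvature_def charts_at_def Let_def bilinear_lneg bilinear_rneg)
  ultimately have "(- ?tr / \<epsilon>) *\<^sub>R n x = (- (\<epsilon> * k)) *\<^sub>R n x" by auto
  moreover have "n x \<noteq> 0" using unit[OF x] \<epsilon> bilinear_lzero[OF form_p(1)] by auto
  ultimately have "- ?tr / \<epsilon> = - (\<epsilon> * k)" by (simp only: scaleR_cancel_right simp_thms)
  then show ?thesis using \<epsilon> by auto
qed

end

section \<open>The graph in a chart of the product\<close>

lemma times_line_simps:
  "pts (times_line M) = pts M \<times> UNIV"
  "idx (times_line M) = idx M \<times> UNIV"
  "cdom (times_line M) (i, j) = cdom M i \<times> UNIV"
  "chart (times_line M) (i, j) = map_prod (chart M i) (\<lambda>t. t)"
  "crange (times_line M) (i, j) = crange M i \<times> UNIV"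
  by (auto simp: prod_mfd_def open_mfd_def crange_def map_prod_def image_iff)

text \<open>\<open>w\<close> and \<open>w'\<close> stand for F' and F'' on \<open>I\<close>.\<close>

locale soliton_graph_chart = unit_submersion_chart M g \<pi> i \<epsilon>
  for M :: "('p, 'i, 'v::euclidean_space) manifold" and g \<pi> i \<epsilon> +
  fixes F w w' :: "real \<Rightarrow> real" and I :: "real set" and \<epsilon>' :: real
  assumes \<epsilon>\<epsilon>': "\<epsilon> * \<epsilon>' = -1" and I: "\<And>x. x \<in> cdom M i \<Longrightarrow> \<pi> x \<in> I"
    and F: "smooth_on I F" "\<And>s. s \<in> I \<Longrightarrow> (F has_real_derivative w s) (at s)"
    and w: "\<And>s. s \<in> I \<Longrightarrow> (w has_real_derivative w' s) (at s)" "\<And>s. s \<in> I \<Longrightarrow> (w s)\<^sup>2 < 1"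
begin

abbreviation "P \<equiv> times_line M"
abbreviation "G \<equiv> prod_metric g (line_metric \<epsilon>')"
abbreviation "S \<equiv> graph_on (pts M) (F \<circ> \<pi>)"
abbreviation "\<rho> z \<equiv> snd z - F (u (fst z))"
abbreviation "N x \<equiv> (- w (\<pi> x) *\<^sub>R n x, \<epsilon>')"

lemma G_eq: "G (i, ()) z v v' = g i (fst z) (fst v) (fst v') + \<epsilon>' * snd v * snd v'"
  by (simp add: prod_metric_def line_metric_def)

lemma \<epsilon>'_eq: "\<epsilon>' = - \<epsilon>" "\<epsilon> * \<epsilon> = 1"
  using \<epsilon> \<epsilon>\<epsilon>' by auto

lemma uI: "y \<in> crange M i \<Longrightarrow> u y \<in> I"
  using I chart_param by auto

lemma open_P: "open (crange M i \<times> (UNIV :: real set))"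
  using op by (intro open_Times) auto

lemma metric_P: "metric_form_on (crange M i \<times> UNIV) (G (i, ()))"
  unfolding metric_form_on_def
proof (intro conjI ballI allI)
  fix z :: "'v \<times> real" assume "z \<in> crange M i \<times> UNIV"
  then have z: "fst z \<in> crange M i" by auto
  note b = form[OF z]
  note bs = bilinear_ladd[OF b(1)] bilinear_radd[OF b(1)] bilinear_lmul[OF b(1)] bilinear_rmul[OF b(1)]
  show "bilinear (G (i, ()) z)"
    by (auto simp: bilinear_def linear_iff G_eq bs algebra_simps)
  show "G (i, ()) z v v' = G (i, ()) z v' v" for v v'
    using b(2) by (simp add: G_eq)
  show "nondegenerate_on (G (i, ()) z) UNIV"
    unfolding nondegenerate_on_def
  proof (intro ballI impI)
    fix v assume v: "\<forall>w\<in>UNIV. G (i, ()) z v w = 0"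
    have "g i (fst z) (fst v) a = 0" for a
    proof -
      have "G (i, ()) z v (a, 0) = 0" using v by blast
      then show ?thesis by (simp add: G_eq)
    qed
    then have "fst v = 0" using b(3) by (simp add: nondegenerate_on_def)
    moreover have "snd v = 0"
    proof -
      have "G (i, ()) z v (0, 1) = 0" using v by blast
      then have "\<epsilon>' * snd v = 0" by (simp add: G_eq bilinear_rzero[OF b(1)])
      moreover have "\<epsilon>' \<noteq> 0" using \<epsilon>\<epsilon>' by auto
      ultimately show ?thesis by simp
    qed
    ultimately show "v = 0" by (simp add: prod_eq_iff)
  qed
next
  fix v v' :: "'v \<times> real"
  have "Ck_on k (crange M i \<times> (UNIV :: real set)) (\<lambda>z. g i (fst z) (fst v) (fst v'))" for k
    by (rule Ck_on_compose[where f="\<lambda>y. g i y (fst v) (fst v')" and g=fst and V="crange M i",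
        OF open_P Ck_on_bounded_linear[OF bounded_linear_fst open_P]])
      (use metric in \<open>auto simp: metric_form_on_def smooth_on_def\<close>)
  then show "smooth_on (crange M i \<times> UNIV) (\<lambda>y. G (i, ()) y v v')"
    unfolding G_eq smooth_on_def by (intro allI Ck_on_add Ck_on_const open_P)
qed

lemma smooth_\<rho>: "smooth_on (crange M i \<times> UNIV) \<rho>"
  unfolding smooth_on_def
proof
  fix k
  have 1: "Ck_on k (crange M i \<times> (UNIV :: real set)) (\<lambda>z. u (fst z))"
    by (rule Ck_on_compose[where f=u and g=fst and V="crange M i",
        OF open_P Ck_on_bounded_linear[OF bounded_linear_fst open_P]])
      (use smooth in \<open>auto simp: smooth_on_def\<close>)
  have "Ck_on k (crange M i \<times> (UNIV :: real set)) (\<lambda>z. F (u (fst z)))"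
    by (rule Ck_on_compose[where f=F and V=I, OF open_P 1]) (use F(1) uI in \<open>auto simp: smooth_on_def\<close>)
  then show "Ck_on k (crange M i \<times> UNIV) \<rho>"
    by (rule Ck_on_diff[OF open_P Ck_on_bounded_linear[OF bounded_linear_snd open_P]])
qed

lemma u_has_derivative: "y \<in> crange M i \<Longrightarrow> (u has_derivative frechet_derivative u (at y)) (at y)"
  using smooth_on_has_derivative[OF smooth] .

lemma compose_u_derivative:
  assumes "y \<in> crange M i" and f: "(f has_real_derivative f') (at (u y))"
  shows "((\<lambda>z::'v \<times> real. f (u (fst z))) has_derivative (\<lambda>X. f' * du y (fst X))) (at (y, t))"
proof -
  have "(fst has_derivative fst) (at (y, t))" by (intro bounded_linear_imp_has_derivative bounded_linear_fst)
  from has_derivative_compose[OF this, of u] u_has_derivative[OF assms(1)]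
  have "((\<lambda>z::'v \<times> real. u (fst z)) has_derivative (\<lambda>X. du y (fst X))) (at (y, t))" by simp
  from has_derivative_compose[OF this, of f "(*) f'"] f show ?thesis
    by (simp add: has_field_derivative_def)
qed

lemma d\<rho>:
  assumes "y \<in> crange M i"
  shows "frechet_derivative \<rho> (at (y, t)) X = snd X - w (u y) * du y (fst X)"
proof -
  have "(\<rho> has_derivative (\<lambda>X. snd X - w (u y) * du y (fst X))) (at (y, t))"
    by (intro has_derivative_diff bounded_linear_imp_has_derivative[OF bounded_linear_snd]
        compose_u_derivative assms F(2) uI)
  then show ?thesis by (simp add: frechet_derivative_eqI)
qed

text \<open>The product metric does not depend on t and its line part is constant, so the Koszul
  terms see only first components, and the factor -w of N comes out by linearity. The term with
  \<open>w'\<close> comes from differentiating w(u) in the differential of F(u).\<close>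

lemma hess_graph:
  assumes "x \<in> cdom M i"
  shows "hess (G (i, ())) \<rho> (N x) (chart M i x, t) X Y =
    - (w' (\<pi> x) * du (chart M i x) (fst X) * du (chart M i x) (fst Y)
      + w (\<pi> x) * hess (g i) u (n x) (chart M i x) (fst X) (fst Y))"
proof -
  define y where "y = chart M i x"
  have y: "y \<in> crange M i" using chart_in assms by (simp add: y_def)
  have uy: "u y = \<pi> x" using param_chart[OF assms] by (simp add: y_def)
  let ?D2 = "frechet_derivative (\<lambda>z. du z (fst Y)) (at y)"
  have fst_der: "(fst has_derivative fst) (at (y, t))"
    by (intro bounded_linear_imp_has_derivative bounded_linear_fst)
  have "((\<lambda>z. du z (fst Y)) has_derivative ?D2) (at y)"
    by (rule smooth_on_has_derivative[OF smooth_on_frechet[OF smooth] y])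
  from has_derivative_compose[OF fst_der, of "\<lambda>z. du z (fst Y)"] this
  have 1: "((\<lambda>z::'v \<times> real. du (fst z) (fst Y)) has_derivative (\<lambda>X. ?D2 (fst X))) (at (y, t))" by simp
  have "((\<lambda>z::'v \<times> real. snd Y - w (u (fst z)) * du (fst z) (fst Y)) has_derivative
      (\<lambda>X. 0 - (w (u (fst (y, t))) * ?D2 (fst X) + w' (u y) * du y (fst X) * du (fst (y, t)) (fst Y)))) (at (y, t))"
    by (intro has_derivative_diff has_derivative_const has_derivative_mult
        compose_u_derivative y w(1) uI 1)
  then have "((\<lambda>z. frechet_derivative \<rho> (at z) Y) has_derivative
      (\<lambda>X. 0 - (w (u (fst (y, t))) * ?D2 (fst X) + w' (u y) * du y (fst X) * du (fst (y, t)) (fst Y)))) (at (y, t))"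
    by (rule has_derivative_transform_within_open[OF _ open_P]) (use y in \<open>auto simp: d\<rho>\<close>)
  from fun_cong[OF frechet_derivative_eqI[OF this], of X]
  have 2: "frechet_derivative (\<lambda>z. frechet_derivative \<rho> (at z) Y) (at (y, t)) X
      = - (w (\<pi> x) * ?D2 (fst X) + w' (\<pi> x) * du y (fst X) * du y (fst Y))"
    by (simp add: uy)
  have dG: "frechet_derivative (\<lambda>z. G (i, ()) z A B) (at (y, t)) C
      = frechet_derivative (\<lambda>z. g i z (fst A) (fst B)) (at y) (fst C)" for A B C
  proof -
    have "smooth_on (crange M i) (\<lambda>z. g i z (fst A) (fst B))"
      using metric by (simp add: metric_form_on_def)
    note smooth_on_has_derivative[OF this y]
    with has_derivative_compose[OF fst_der, of "\<lambda>z. g i z (fst A) (fst B)"]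
    have "((\<lambda>z::'v \<times> real. g i (fst z) (fst A) (fst B)) has_derivative
        (\<lambda>X. frechet_derivative (\<lambda>z. g i z (fst A) (fst B)) (at y) (fst X))) (at (y, t))" by simp
    from has_derivative_add[OF this has_derivative_const[of "\<epsilon>' * snd A * snd B"]]
    have "((\<lambda>z. G (i, ()) z A B) has_derivative
        (\<lambda>X. frechet_derivative (\<lambda>z. g i z (fst A) (fst B)) (at y) (fst X))) (at (y, t))"
      by (simp add: G_eq)
    then show ?thesis by (simp add: frechet_derivative_eqI)
  qed
  have "koszul (G (i, ())) (y, t) X Y (N x) = koszul (g i) y (fst X) (fst Y) (- w (\<pi> x) *\<^sub>R n x)"
    by (simp add: koszul_def dG)
  also have "\<dots> = - w (\<pi> x) * koszul (g i) y (fst X) (fst Y) (n x)"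
    using linear_scale[OF koszul_linear(1)[OF op y metric]] by (simp only: real_scaleR_def)
  finally show ?thesis using 2 unfolding hess_def y_def[symmetric] by (simp add: algebra_simps)
qed

text \<open>Raising the index of dt divides by \<epsilon>', which is its own inverse. In the square,
  \<epsilon> = -\<epsilon>' turns \<epsilon> w^2 + \<epsilon>' into \<epsilon>' (1 - w^2).\<close>

lemma graph_normal:
  assumes x: "x \<in> cdom M i"
  shows "G (i, ()) (chart M i x, t) (N x) X = snd X - w (\<pi> x) * du (chart M i x) (fst X)"
    "G (i, ()) (chart M i x, t) (N x) (N x) = \<epsilon>' * (1 - (w (\<pi> x))\<^sup>2)"
proof -
  note b = form[OF chart_in[OF x]]
  have "\<epsilon>' * \<epsilon>' = 1" using \<epsilon>'_eq by simp
  then show *: "G (i, ()) (chart M i x, t) (N x) X = snd X - w (\<pi> x) * du (chart M i x) (fst X)" for X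
    using gradient[OF x] by (simp add: G_eq bilinear_lmul[OF b(1)] bilinear_lneg[OF b(1)])
  show "G (i, ()) (chart M i x, t) (N x) (N x) = \<epsilon>' * (1 - (w (\<pi> x))\<^sup>2)"
    using linear_scale[OF du_linear[OF chart_in[OF x]]] du_gradient[OF x] \<epsilon>'_eq(1)
    unfolding * by (simp add: power2_eq_square algebra_simps linear_neg[OF du_linear[OF chart_in[OF x]]])
qed

lemma graph_point:
  assumes x: "x \<in> cdom M i"
  shows "level_hypersurface_point P G S (i, ()) \<rho> (x, F (\<pi> x)) (N x)"
proof
  show "inj_on (chart P (i, ())) (cdom P (i, ()))"
    using inj by (auto simp: times_line_simps inj_on_def)
  show "open (crange P (i, ()))" "metric_form_on (crange P (i, ())) (G (i, ()))"
    "smooth_on (crange P (i, ())) \<rho>"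
    using open_P metric_P smooth_\<rho> by (simp_all add: times_line_simps)
  show "\<exists>n. frechet_derivative \<rho> (at z) n \<noteq> 0" if zP: "z \<in> crange P (i, ())" for z
  proof -
    obtain y t where z: "z = (y, t)" "y \<in> crange M i" using zP by (auto simp: times_line_simps)
    then show ?thesis
      using d\<rho>[of y t "(0, 1)"] linear_0[OF du_linear] by (intro exI[of _ "(0, 1)"]) simp
  qed
  show "q \<in> S \<longleftrightarrow> \<rho> (chart P (i, ()) q) = 0" if "q \<in> cdom P (i, ())" for q
    using that dom param_chart by (auto simp: times_line_simps graph_on_def)
  show "(x, F (\<pi> x)) \<in> S" "(x, F (\<pi> x)) \<in> cdom P (i, ())"
    using x dom by (auto simp: times_line_simps graph_on_def)
  show "G (i, ()) (chart P (i, ()) (x, F (\<pi> x))) (N x) X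
      = frechet_derivative \<rho> (at (chart P (i, ()) (x, F (\<pi> x)))) X" for X
    using graph_normal(1)[OF x] d\<rho>[OF chart_in[OF x]] param_chart[OF x]
    by (simp add: times_line_simps)
  show "G (i, ()) (chart P (i, ()) (x, F (\<pi> x))) (N x) (N x) \<noteq> 0"
    using graph_normal(2)[OF x] w(2)[OF I[OF x]] \<epsilon>'_eq \<epsilon> by (auto simp: times_line_simps)
qed

text \<open>Both sides are multiples of N. The mean curvature vector has coefficient -tr / <N, N>,
  and the normal part of the vertical field has <N, (0, 1)> / <N, N> with <N, (0, 1)> = d\<rho>(0,
  1) = 1. Hence the trace has to be -1.\<close>

lemma graph_soliton_equation:
  assumes x: "x \<in> cdom M i"
    and ode: "w' (\<pi> x) = (\<epsilon> + \<epsilon>' * (w (\<pi> x))\<^sup>2) * (1 - w (\<pi> x) * k)"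
    and mc: "has_mean_curvature M g {z \<in> pts M. \<pi> z = \<pi> x} (\<lambda>i x. - gradient M g \<pi> i x) (\<lambda>_. k)"
  shows "mean_curvature_vector P G S (i, ()) (x, F (\<pi> x))
    = normal_part (G (i, ()) (chart P (i, ()) (x, F (\<pi> x)))) (tangent_space P S (i, ()) (x, F (\<pi> x))) (0, 1)"
proof -
  interpret L: level_hypersurface_point P G S "(i, ())" \<rho> "(x, F (\<pi> x))" "N x"
    by (rule graph_point[OF x])
  define y where "y = chart M i x"
  define t where "t = F (\<pi> x)"
  define \<omega> where "\<omega> = w (\<pi> x)"
  have y: "y \<in> crange M i" using chart_in x by (simp add: y_def)
  have cy: "chart P (i, ()) (x, F (\<pi> x)) = (y, t)" by (simp add: times_line_simps y_def t_def)
  have \<omega>: "\<omega>\<^sup>2 < 1" using w(2) I x by (simp add: \<omega>_def)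
  note b = form[OF y]
  note dl = du_linear[OF y]
  have grad: "g i y (n x) v = du y v" for v using gradient[OF x] by (simp add: y_def)
  have dn: "du y (n x) = \<epsilon>" using du_gradient[OF x] by (simp add: y_def)
  have nn: "g i y (n x) (n x) = \<epsilon>" by (simp add: grad dn)
  have T: "L.T = {X. snd X = \<omega> * du y (fst X)}"
    unfolding L.T_eq using graph_normal(1)[OF x] by (auto simp: cy y_def \<omega>_def times_line_simps)
  let ?K = "{v. du y v = 0}"
  have K: "?K = {v. g i y (n x) v = 0}" by (simp add: grad)
  obtain E where E: "orthonormal_basis_of (g i y) ?K E"
    using orthonormal_basis_exists[OF b(1,2) subspace_orthogonal[OF b(1)]
        nondegenerate_orthogonal[OF b, of "n x"]] nn \<epsilon> unfolding K by auto
  have trE: "(\<Sum>e\<in>E. g i y e e * hess (g i) u (n x) y e e) = k"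
    using fibre_hess_trace[OF x refl mc] E by (simp add: y_def)
  define c where "c = 1 / sqrt (1 - \<omega>\<^sup>2)"
  have c2: "c * c * (1 - \<omega>\<^sup>2) = 1" and c0: "c \<noteq> 0" using \<omega> by (simp_all add: c_def)
  define X where "X = (c *\<^sub>R n x, c * \<omega> * \<epsilon>)"
  let ?j = "\<lambda>e::'v. (e, 0::real)"
  let ?b = "G (i, ()) (y, t)"
  have jj: "?b (?j v) (?j v') = g i y v v'" for v v' by (simp add: G_eq)
  have jX: "?b (?j v) X = c * du y v" "?b X (?j v) = c * du y v" for v
    using grad b(2) by (simp_all add: G_eq X_def bilinear_lmul[OF b(1)] bilinear_rmul[OF b(1)])
  have XX: "?b X X = \<epsilon>"
  proof -
    have "?b X X = c * c * \<epsilon> + \<epsilon>' * (c * c * \<omega>\<^sup>2) * (\<epsilon> * \<epsilon>)"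
      by (simp add: G_eq X_def bilinear_lmul[OF b(1)] bilinear_rmul[OF b(1)] nn power2_eq_square)
    also have "\<dots> = \<epsilon> * (c * c * (1 - \<omega>\<^sup>2))"
      using \<epsilon>'_eq by (simp add: algebra_simps)
    finally show ?thesis by (simp add: c2)
  qed
  have EK: "E \<subseteq> ?K" "span E = ?K" "finite E"
    and Ee: "\<And>e. e \<in> E \<Longrightarrow> g i y e e \<in> {1, -1}" "\<And>e e'. e \<in> E \<Longrightarrow> e' \<in> E \<Longrightarrow> e \<noteq> e' \<Longrightarrow> g i y e e' = 0"
    using E by (auto simp: orthonormal_basis_of_def)
  \<comment> \<open>\<open>X\<close> has square \<epsilon> but is orthogonal to each
    \<open>?j e\<close>; being new, it contributes its own term to the sum.\<close>
  have XE: "X \<notin> ?j ` E"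
    using EK(1) XX \<epsilon> jX(1) by fastforce
  have onb: "orthonormal_basis_of ?b L.T (insert X (?j ` E))"
    unfolding orthonormal_basis_of_def
  proof (intro conjI)
    show "finite (insert X (?j ` E))" using EK by simp
    show sub: "insert X (?j ` E) \<subseteq> L.T"
      using EK(1) dn by (auto simp: T X_def linear_scale[OF dl])
    show "\<forall>e\<in>insert X (?j ` E). ?b e e \<in> {1, -1}"
      using \<epsilon> XX Ee(1) by (auto simp: jj)
    show "\<forall>e\<in>insert X (?j ` E). \<forall>e'\<in>insert X (?j ` E). e \<noteq> e' \<longrightarrow> ?b e e' = 0"
      using Ee(2) EK(1) by (auto simp: jj jX)
    have lj: "linear ?j" by (auto simp: linear_iff)
    show "span (insert X (?j ` E)) = L.T"
    proof
      show "span (insert X (?j ` E)) \<subseteq> L.T" using span_minimal[OF sub L.T_subspace] .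
      show "L.T \<subseteq> span (insert X (?j ` E))"
      proof
        fix Z assume "Z \<in> L.T"
        then have Z: "snd Z = \<omega> * du y (fst Z)" by (simp add: T)
        \<comment> \<open>The coefficient of \<nabla>\<pi> in \<open>fst Z\<close>, as
          d\<pi>(\<nabla>\<pi>) = \<epsilon>. Subtracting \<open>(r / c)\<close> times
          \<open>X\<close> then also removes the second component.\<close>
        define r where "r = \<epsilon> * du y (fst Z)"
        have "fst Z - r *\<^sub>R n x \<in> ?K"
          using \<epsilon>'_eq(2) by (simp add: r_def linear_diff[OF dl] linear_scale[OF dl] dn mult.commute mult.left_commute)
        then have "?j (fst Z - r *\<^sub>R n x) \<in> span (?j ` E)"
          using linear_span_image[OF lj, of E] EK(2) by auto
        moreover have "Z - (r / c) *\<^sub>R X = ?j (fst Z - r *\<^sub>R n x)"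
          using \<epsilon>'_eq(2) c0 Z by (auto simp: prod_eq_iff X_def r_def)
        ultimately have "Z - (r / c) *\<^sub>R X \<in> span (?j ` E)" by simp
        then show "Z \<in> span (insert X (?j ` E))" unfolding span_insert by blast
      qed
    qed
  qed
  define H where "H = hess (G (i, ())) \<rho> (N x) (y, t)"
  have hess_H: "H X Y = - (w' (\<pi> x) * du y (fst X) * du y (fst Y)
      + \<omega> * hess (g i) u (n x) y (fst X) (fst Y))" for X Y
    using hess_graph[OF x] unfolding H_def y_def \<omega>_def .
  have HjX: "H (?j e) (?j e) = - \<omega> * hess (g i) u (n x) y e e" if "e \<in> E" for e
    using EK(1) that by (auto simp: hess_H)
  note bil = bilinear_hess[OF op y metric smooth, of "n x"]
  \<comment> \<open>The Hessian of \<pi> vanishes on \<nabla>\<pi>, so only the term with F''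
    survives, with d\<pi> of the first component equal to c \<epsilon>.\<close>
  have HXX: "H X X = - (w' (\<pi> x) * (c * c))"
    using hess_gradient[OF x] \<epsilon>'_eq(2) dn
    by (simp add: hess_H X_def bilinear_lmul[OF bil] bilinear_rmul[OF bil] linear_scale[OF dl] flip: y_def)
  have "(\<Sum>e\<in>insert X (?j ` E). ?b e e * H e e)
      = \<epsilon> * - (w' (\<pi> x) * (c * c)) + (\<Sum>e\<in>E. g i y e e * (- \<omega> * hess (g i) u (n x) y e e))"
    using EK(3) XE by (simp add: XX HXX sum.reindex inj_on_def jj HjX)
  also have "(\<Sum>e\<in>E. g i y e e * (- \<omega> * hess (g i) u (n x) y e e)) = - \<omega> * k"
    by (simp add: sum_distrib_left mult.left_commute flip: trE)
  \<comment> \<open>Here the differential equation enters. With c^2 (1 - \<omega>^2) = 1 the whole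
    trace becomes -(1 - \<omega> k) - \<omega> k = -1.\<close>
  also have "\<epsilon> * - (w' (\<pi> x) * (c * c)) = - (c * c * (1 - \<omega>\<^sup>2)) * (1 - \<omega> * k)"
  proof -
    have "\<epsilon> * w' (\<pi> x) = (1 - \<omega>\<^sup>2) * (1 - \<omega> * k)"
    proof -
      have "w' (\<pi> x) = \<epsilon> * ((1 - \<omega>\<^sup>2) * (1 - \<omega> * k))"
        using ode \<epsilon>'_eq(1) by (simp add: \<omega>_def algebra_simps)
      then have "\<epsilon> * w' (\<pi> x) = (\<epsilon> * \<epsilon>) * ((1 - \<omega>\<^sup>2) * (1 - \<omega> * k))" by simp
      then show ?thesis using \<epsilon>'_eq(2) by simp
    qed
    moreover have "\<epsilon> * - (w' (\<pi> x) * (c * c)) = - (c * c) * (\<epsilon> * w' (\<pi> x))" by simp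
    ultimately show ?thesis by (simp only: mult.assoc mult_minus_left)
  qed
  finally have tr: "(\<Sum>e\<in>insert X (?j ` E). ?b e e * H e e) = -1" by (simp add: c2)
  have "mean_curvature_vector P G S (i, ()) (x, F (\<pi> x)) = (1 / ?b (N x) (N x)) *\<^sub>R N x"
    using L.mean_curvature_vector_eq[of "insert X (?j ` E)"] onb tr unfolding cy H_def by simp
  moreover have "?b (N x) (0, 1) = 1"
    using graph_normal(1)[OF x, of t "(0, 1)"] linear_0[OF dl] by (simp add: y_def)
  moreover have "normal_part ?b L.T (0, 1) = (?b (N x) (0, 1) / ?b (N x) (N x)) *\<^sub>R N x"
    using normal_part_orthogonal[OF L.form_p L.nn, of "(0, 1)"] unfolding L.T_eq cy .
  ultimately show ?thesis unfolding cy by simp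
qed

end

section \<open>Global solutions and their graphs\<close>

lemma tanh_artanh_real:
  fixes x :: real
  assumes "\<bar>x\<bar> < 1"
  shows "tanh (artanh x) = x"
proof -
  have p: "1 + x > 0" "1 - x > 0" using assms by auto
  have "exp (- 2 * artanh x) = exp (- ln ((1 + x) / (1 - x)))" by (simp add: artanh_def)
  also have "\<dots> = (1 - x) / (1 + x)" using p by (simp add: exp_minus)
  finally have "exp (- 2 * artanh x) = (1 - x) / (1 + x)" .
  then show ?thesis using p unfolding tanh_real_altdef by (simp only:) (simp add: field_simps)
qed

lemma tanh_real_lipschitz: "\<bar>tanh x - tanh y\<bar> \<le> \<bar>x - (y::real)\<bar>"
proof -
  have sq: "(tanh z)\<^sup>2 < 1" for z :: real
    using tanh_real_bounds[of z] by (simp add: abs_square_less_1 abs_if)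
  have "norm (tanh x - tanh y) \<le> 1 * norm (x - y)"
  proof (rule field_differentiable_bound[of UNIV])
    show "(tanh has_field_derivative 1 - (tanh z)\<^sup>2) (at z within UNIV)" for z :: real
      using has_field_derivative_tanh[OF cosh_real_nonzero DERIV_ident, of z] by simp
    show "norm (1 - (tanh z)\<^sup>2) \<le> 1" for z :: real
      using sq[of z] by simp
  qed auto
  then show ?thesis by simp
qed

lemma soliton_slope_exists:
  fixes h :: "real \<Rightarrow> real"
  assumes I: "open I" "is_interval I" "s0 \<in> I" and h: "continuous_on I h" and w0: "w0\<^sup>2 < 1"
  shows "\<exists>w. w s0 = w0 \<and> (\<forall>s\<in>I. (w s)\<^sup>2 < 1 \<and>
    (w has_real_derivative \<epsilon> * ((1 - (w s)\<^sup>2) * (1 - w s * h s))) (at s))"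
proof -
  let ?\<Psi> = "\<lambda>s x. \<epsilon> * (1 - h s * tanh x)"
  have "\<exists>\<theta>. \<theta> s0 = artanh w0 \<and> (\<forall>s\<in>I. (\<theta> has_real_derivative ?\<Psi> s (\<theta> s)) (at s))"
  proof (rule lipschitz_ode_global_solution[OF I, where k="\<lambda>s. \<bar>\<epsilon> * h s\<bar>"])
    show "continuous_on I (\<lambda>s. ?\<Psi> s (\<theta> s))" if "continuous_on I \<theta>" for \<theta>
      using that h by (intro continuous_intros) auto
    show "continuous_on I (\<lambda>s. \<bar>\<epsilon> * h s\<bar>)" using h by (intro continuous_intros)
    show "\<bar>?\<Psi> s x - ?\<Psi> s y\<bar> \<le> \<bar>\<epsilon> * h s\<bar> * \<bar>x - y\<bar>" for s x y
    proof -
      have "?\<Psi> s x - ?\<Psi> s y = - (\<epsilon> * h s) * (tanh x - tanh y)" by (simp add: algebra_simps)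
      then show ?thesis
        using mult_left_mono[OF tanh_real_lipschitz[of x y], of "\<bar>\<epsilon> * h s\<bar>"] by (simp add: abs_mult)
    qed
  qed
  then obtain \<theta> where \<theta>: "\<theta> s0 = artanh w0"
    "\<And>s. s \<in> I \<Longrightarrow> (\<theta> has_real_derivative ?\<Psi> s (\<theta> s)) (at s)" by blast
  show ?thesis
  proof (intro exI[of _ "\<lambda>s. tanh (\<theta> s)"] conjI ballI)
    show "tanh (\<theta> s0) = w0" using w0 by (simp add: \<theta>(1) tanh_artanh_real abs_square_less_1)
    show "(tanh (\<theta> s))\<^sup>2 < 1" for s
      using tanh_real_bounds[of "\<theta> s"] by (simp add: abs_square_less_1 abs_if)
    show "((\<lambda>s. tanh (\<theta> s)) has_real_derivative
        \<epsilon> * ((1 - (tanh (\<theta> s))\<^sup>2) * (1 - tanh (\<theta> s) * h s))) (at s)" if "s \<in> I" for s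
      using has_field_derivative_tanh[OF cosh_real_nonzero \<theta>(2)[OF that]]
      by (simp add: mult_ac)
  qed
qed

text \<open>The difference of two solutions solves a linear homogeneous equation.\<close>

lemma soliton_slope_unique:
  fixes h v w :: "real \<Rightarrow> real"
  assumes J: "open J" "is_interval J" "s0 \<in> J" and h: "continuous_on J h"
    and v: "\<And>s. s \<in> J \<Longrightarrow> (v has_real_derivative \<epsilon> * ((1 - (v s)\<^sup>2) * (1 - v s * h s))) (at s)"
    and w: "\<And>s. s \<in> J \<Longrightarrow> (w has_real_derivative \<epsilon> * ((1 - (w s)\<^sup>2) * (1 - w s * h s))) (at s)"
    and "v s0 = w s0" "s \<in> J"
  shows "v s = w s"
proof -
  \<comment> \<open>The divided difference of the cubic \<epsilon> (1 - x^2) (1 - x h) between the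
    values of v and w.\<close>
  define q where "q s = \<epsilon> * (h s * ((v s)\<^sup>2 + v s * w s + (w s)\<^sup>2) - (v s + w s) - h s)" for s
  have "continuous_on J v" "continuous_on J w"
    using v w by (auto intro!: continuous_at_imp_continuous_on DERIV_isCont)
  then have q: "continuous_on J q" unfolding q_def using h by (intro continuous_intros)
  have "((\<lambda>s. v s - w s) has_real_derivative q s * (v s - w s)) (at s)" if "s \<in> J" for s
  proof -
    have "\<epsilon> * ((1 - (v s)\<^sup>2) * (1 - v s * h s)) - \<epsilon> * ((1 - (w s)\<^sup>2) * (1 - w s * h s)) = q s * (v s - w s)"
      by (simp add: q_def power2_eq_square algebra_simps)
    then show ?thesis using DERIV_diff[OF v[OF that] w[OF that]] by simp
  qed
  from linear_ode_zero[OF J q this] show ?thesis using assms(7,8) by simp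
qed

lemma Ck_on_Suc_real:
  fixes f f' :: "real \<Rightarrow> real"
  assumes "open I" "\<And>s. s \<in> I \<Longrightarrow> (f has_real_derivative f' s) (at s)" "Ck_on k I f'"
  shows "Ck_on (Suc k) I f"
  using assms by (intro Ck_on_SucI[where D="\<lambda>s. (*) (f' s)"] Ck_on_mult Ck_on_const)
    (auto simp: has_field_derivative_def)

text \<open>Bootstrapping: if w is of class C^k, so is the right-hand side, which is w'; hence w is
  of class C^(k+1).\<close>

lemma soliton_slope_smooth:
  fixes h w :: "real \<Rightarrow> real"
  assumes I: "open I" and h: "smooth_on I h"
    and w: "\<And>s. s \<in> I \<Longrightarrow> (w has_real_derivative \<epsilon> * ((1 - (w s)\<^sup>2) * (1 - w s * h s))) (at s)"
  shows "smooth_on I w"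
  unfolding smooth_on_def
proof
  show "Ck_on k I w" for k
  proof (induction k)
    case 0
    then show ?case using w by (auto intro!: continuous_at_imp_continuous_on DERIV_isCont)
  next
    case (Suc k)
    have "Ck_on k I h" using h by (simp add: smooth_on_def)
    then have "Ck_on k I (\<lambda>s. \<epsilon> * ((1 - w s * w s) * (1 - w s * h s)))"
      by (intro Ck_on_mult Ck_on_diff Ck_on_const I Suc)
    then show ?case using w by (intro Ck_on_Suc_real[OF I]) (auto simp: power2_eq_square)
  qed
qed

text \<open>The equation contains f only through f', so it is solved as a first-order equation for
  the slope and integrated once. Agreement with f on \<open>J\<close> is likewise obtained for the
  slopes first.\<close>

lemma soliton_ode_global_solution:
  fixes f h :: "real \<Rightarrow> real"
  assumes I: "open I" "is_interval I" and h: "smooth_on I h"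
    and J: "open J" "is_interval J" "s0 \<in> J" "J \<subseteq> I"
    and \<epsilon>: "\<epsilon>' = - \<epsilon>"
    and f: "soliton_ode_solution \<epsilon> \<epsilon>' h J f" and "(deriv f s0)\<^sup>2 < 1"
  obtains F where "soliton_ode_solution \<epsilon> \<epsilon>' h I F" "\<And>s. s \<in> J \<Longrightarrow> F s = f s"
    "smooth_on I F" "\<And>s. s \<in> I \<Longrightarrow> (deriv F s)\<^sup>2 < 1"
proof -
  have rhs: "(\<epsilon> + \<epsilon>' * x\<^sup>2) * c = \<epsilon> * ((1 - x\<^sup>2) * c)" for x c :: real
    by (simp add: \<epsilon> algebra_simps)
  have ch: "continuous_on I h" using smooth_on_continuous_on[OF h] .
  have s0: "s0 \<in> I" using J by blast
  obtain w where w: "w s0 = deriv f s0" "\<And>s. s \<in> I \<Longrightarrow> (w s)\<^sup>2 < 1"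
    "\<And>s. s \<in> I \<Longrightarrow> (w has_real_derivative \<epsilon> * ((1 - (w s)\<^sup>2) * (1 - w s * h s))) (at s)"
    using soliton_slope_exists[OF I s0 ch assms(10)] by metis
  have cw: "continuous_on I w" using w(3) by (auto intro!: continuous_at_imp_continuous_on DERIV_isCont)
  obtain F where F: "F s0 = f s0" "\<And>s. s \<in> I \<Longrightarrow> (F has_real_derivative w s) (at s)"
    using antiderivative_on_interval[OF I s0 cw, of "f s0"] by blast
  have dF: "deriv F s = w s" if "s \<in> I" for s using F(2)[OF that] by (rule DERIV_imp_deriv)
  have dw: "(deriv F has_real_derivative \<epsilon> * ((1 - (w s)\<^sup>2) * (1 - w s * h s))) (at s)" if "s \<in> I" for s
    by (rule has_field_derivative_transform_within_open[OF w(3)[OF that] I(1) that]) (simp add: dF)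
  have sol: "soliton_ode_solution \<epsilon> \<epsilon>' h I F"
    unfolding soliton_ode_solution_def rhs
    using F(2) dw by (auto simp: dF real_differentiable_def)
  have sw: "smooth_on I w" by (rule soliton_slope_smooth[OF I(1) h w(3)])
  have sF: "smooth_on I F"
    unfolding smooth_on_def
  proof
    fix k
    have "Ck_on (Suc k) I F"
      using sw F(2) by (intro Ck_on_Suc_real[OF I(1), of F w]) (auto simp: smooth_on_def)
    then show "Ck_on k I F" by (rule Ck_on_SucD)
  qed
  have fd: "(f has_real_derivative deriv f s) (at s)"
    "(deriv f has_real_derivative \<epsilon> * ((1 - (deriv f s)\<^sup>2) * (1 - deriv f s * h s))) (at s)" if "s \<in> J" for s
    using f that unfolding soliton_ode_solution_def rhs by (auto simp: DERIV_deriv_iff_real_differentiable)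
  have wf: "w s = deriv f s" if "s \<in> J" for s
    by (rule soliton_slope_unique[OF J(1-3), of h w \<epsilon>])
      (use w(1,3) fd(2) J(4) that continuous_on_subset[OF ch] in auto)
  have "F s = f s" if "s \<in> J" for s
  proof -
    \<comment> \<open>The zero derivative is written as a product to match the linear equation with
      coefficient 0.\<close>
    have "((\<lambda>s. F s - f s) has_real_derivative 0 * (F s - f s)) (at s)" if "s \<in> J" for s
      using DERIV_diff[OF F(2) fd(1)[OF that]] wf[OF that] J(4) that by auto
    from linear_ode_zero[OF J(1-3) _ this] show ?thesis using F(1) that by auto
  qed
  then show ?thesis using that[OF sol _ sF] w(2) dF by simp
qed

section \<open>From the manifold to its charts, and the conclusion\<close>

lemma smooth_manifold_chart:
  assumes M: "smooth_manifold M" and i: "i \<in> idx M"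
  shows "cdom M i \<subseteq> pts M" "inj_on (chart M i) (cdom M i)" "open (crange M i)"
    "\<And>W. openin (mtop M) W \<Longrightarrow> open (chart M i ` (cdom M i \<inter> W))"
proof -
  have o: "openin (mtop M) (cdom M i)" and op: "open (crange M i)"
    and hm: "homeomorphic_map (subtopology (mtop M) (cdom M i)) (top_of_set (crange M i)) (chart M i)"
    using M i by (auto simp: smooth_manifold_def)
  show sub: "cdom M i \<subseteq> pts M" using openin_subset[OF o] .
  then have top: "topspace (subtopology (mtop M) (cdom M i)) = cdom M i" by auto
  show "inj_on (chart M i) (cdom M i)" using homeomorphic_imp_injective_map[OF hm] top by simp
  show "open (crange M i)" by (rule op)
  show "open (chart M i ` (cdom M i \<inter> W))" if "openin (mtop M) W" for W
  proof -
    have "openin (subtopology (mtop M) (cdom M i)) (cdom M i \<inter> W)"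
      using that by (auto simp: openin_subtopology)
    then have "openin (top_of_set (crange M i)) (chart M i ` (cdom M i \<inter> W))"
      using homeomorphic_imp_open_map[OF hm] by (simp add: open_map_def)
    then show ?thesis using op openin_open_trans by blast
  qed
qed

lemma decomposable_chart:
  fixes M :: "('p, 'i, 'v::euclidean_space) manifold"
  assumes D: "decomposable M g L G \<phi> Q I \<pi> \<epsilon> h" and i: "i \<in> idx M"
  shows "unit_submersion_chart M g \<pi> i \<epsilon>"
proof -
  have M: "smooth_manifold M" and g: "pseudo_riemannian_metric M g"
    and sub: "pseudo_riemannian_submersion M g (open_mfd I) (line_metric \<epsilon>) \<pi>"
    and \<epsilon>: "\<epsilon> \<in> {1, -1}"
    and unit: "\<forall>x\<in>pts M. \<forall>i\<in>charts_at M x. g i (chart M i x) (gradient M g \<pi> i x) (gradient M g \<pi> i x) = \<epsilon>"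
    using D by (auto simp: decomposable_def)
  note c = smooth_manifold_chart[OF M i]
  have "smooth_map M (open_mfd I) \<pi>" and im: "\<pi> ` pts M = I"
    using sub by (auto simp: pseudo_riemannian_submersion_def submersion_def open_mfd_def)
  then have "smooth_on (chart M i ` {x \<in> cdom M i. \<pi> x \<in> I}) (\<lambda>y. \<pi> (param M i y))"
    using i by (auto simp: smooth_map_def open_mfd_def local_rep_def comp_def)
  moreover have "chart M i ` {x \<in> cdom M i. \<pi> x \<in> I} = crange M i"
    using c(1) im by (auto simp: crange_def)
  ultimately have "smooth_on (crange M i) (\<lambda>y. \<pi> (param M i y))" by simp
  then show ?thesis
    using c(1-3) g unit \<epsilon> i
    by unfold_locales (auto simp: metric_form_on_def pseudo_riemannian_metric_def charts_at_def)
qed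

theorem corollary3p2:
  fixes M :: "('p, 'i, 'v::euclidean_space) manifold"
    and g :: "('i, 'v) metric_tensor"
    and L :: "('s, 'k, 'l::real_normed_vector) manifold"
    and G :: "('s, 'z) monoid_scheme"
    and \<phi> :: "'s \<Rightarrow> 'p \<Rightarrow> 'p"
    and Q :: "('s set, 'j, 'q::real_normed_vector) manifold"
    and I J :: "real set"
    and \<pi> :: "'p \<Rightarrow> real"
    and h f :: "real \<Rightarrow> real"
    and \<epsilon> \<epsilon>' s\<^sub>0 :: real
  assumes "decomposable M g L G \<phi> Q I \<pi> \<epsilon> h"
    and "\<epsilon>' \<in> {1, -1}" and "\<epsilon> * \<epsilon>' = -1"
    and "open J" and "is_interval J" and "s\<^sub>0 \<in> J" and "J \<subseteq> I"
    and "soliton_ode_solution \<epsilon> \<epsilon>' h J f"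
    and "(deriv f s\<^sub>0)\<^sup>2 < 1"
  shows "\<exists>F. soliton_ode_solution \<epsilon> \<epsilon>' h I F \<and> (\<forall>s\<in>J. F s = f s) \<and>
           smooth_map M (times_line M) (\<lambda>x. (x, F (\<pi> x))) \<and>
           translating_soliton M g \<epsilon>' (graph_on (pts M) (F \<circ> \<pi>)) \<and>
           invariant_under G \<phi> (graph_on (pts M) (F \<circ> \<pi>)) \<and>
           graph_on {x \<in> pts M. \<pi> x \<in> J} (f \<circ> \<pi>) \<subseteq> graph_on (pts M) (F \<circ> \<pi>)"
proof -
  note D = assms(1)
  have M: "smooth_manifold M" and act: "proper_isometric_action L G M g \<phi>"
    and I: "open I" "is_interval I" and \<epsilon>: "\<epsilon> \<in> {1, -1}"
    and sub: "pseudo_riemannian_submersion M g (open_mfd I) (line_metric \<epsilon>) \<pi>"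
    and fib: "\<And>x. x \<in> pts M \<Longrightarrow> {y \<in> pts M. \<pi> y = \<pi> x} = orbit G \<phi> x"
    and h: "smooth_on I h"
    and mc: "\<And>s. s \<in> I \<Longrightarrow> has_mean_curvature M g {x \<in> pts M. \<pi> x = s} (\<lambda>i x. - gradient M g \<pi> i x) (\<lambda>_. h s)"
    using D by (auto simp: decomposable_def)
  have \<pi>s: "smooth_map M (open_mfd I) \<pi>" and im: "\<pi> ` pts M = I"
    using sub by (auto simp: pseudo_riemannian_submersion_def submersion_def open_mfd_def)
  have \<epsilon>': "\<epsilon>' = - \<epsilon>" using \<epsilon> assms(3) by auto
  obtain F where sol: "soliton_ode_solution \<epsilon> \<epsilon>' h I F" and FJ: "\<And>s. s \<in> J \<Longrightarrow> F s = f s"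
    and sF: "smooth_on I F" and w1: "\<And>s. s \<in> I \<Longrightarrow> (deriv F s)\<^sup>2 < 1"
    using soliton_ode_global_solution[OF I h assms(4-7) \<epsilon>' assms(8,9)] by blast
  \<comment> \<open>F'' is named by the right-hand side of the equation, so the pointwise hypothesis
    of \<open>graph_soliton_equation\<close> holds by definition.\<close>
  define w' where "w' s = (\<epsilon> + \<epsilon>' * (deriv F s)\<^sup>2) * (1 - deriv F s * h s)" for s
  have chart: "soliton_graph_chart M g \<pi> i \<epsilon> F (deriv F) w' I \<epsilon>'" if i: "i \<in> idx M" for i
  proof -
    interpret unit_submersion_chart M g \<pi> i \<epsilon> by (rule decomposable_chart[OF D i])
    show ?thesis
    proof unfold_locales
      show "\<pi> x \<in> I" if "x \<in> cdom M i" for x using that dom im by blast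
      show "(F has_real_derivative deriv F s) (at s)" "(deriv F has_real_derivative w' s) (at s)"
        if "s \<in> I" for s
        using sol that by (auto simp: soliton_ode_solution_def w'_def DERIV_deriv_iff_real_differentiable)
    qed (use assms(3) sF w1 in auto)
  qed
  let ?P = "times_line M" and ?S = "graph_on (pts M) (F \<circ> \<pi>)"
  have inP: "\<exists>i\<in>idx M. x \<in> cdom M i" if "x \<in> pts M" for x
    using M that by (auto simp: smooth_manifold_def)
  have F_map: "smooth_map M ?P (\<lambda>x. (x, F (\<pi> x)))"
    unfolding smooth_map_def
  proof (intro conjI ballI)
    have "continuous_map (mtop M) (top_of_set I) \<pi>" using \<pi>s by (simp add: smooth_map_def open_mfd_def)
    moreover have "continuous_map (top_of_set I) euclidean F"
      using smooth_on_continuous_on[OF sF] by simp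
    ultimately have "continuous_map (mtop M) euclidean (F \<circ> \<pi>)" by (rule continuous_map_compose)
    then show "continuous_map (mtop M) (mtop ?P) (\<lambda>x. (x, F (\<pi> x)))"
      by (simp add: prod_mfd_def open_mfd_def continuous_map_pairedI comp_def)
  next
    fix i k assume i: "i \<in> idx M" and k: "k \<in> idx ?P"
    then obtain j where j: "k = (j, ())" "j \<in> idx M" by (auto simp: times_line_simps)
    interpret soliton_graph_chart M g \<pi> i \<epsilon> F "deriv F" w' I \<epsilon>' by (rule chart[OF i])
    \<comment> \<open>The source chart \<open>i\<close> and the chart \<open>j\<close> of the first
      target factor may differ; on their overlap the local representative pairs the transition map
      with F(\<pi>).\<close>
    let ?W = "chart M i ` (cdom M i \<inter> cdom M j)"
    have "openin (mtop M) (cdom M j)" using M j by (simp add: smooth_manifold_def)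
    then have W: "open ?W" using smooth_manifold_chart(4)[OF M i] by blast
    have Wsub: "?W \<subseteq> crange M i" by (auto simp: crange_def)
    have "smooth_on ?W (\<lambda>y. chart M j (param M i y))"
      using M i j by (simp add: smooth_manifold_def comp_def)
    moreover have "smooth_on ?W (\<lambda>y. F (\<pi> (param M i y)))"
      by (rule smooth_on_compose[OF W smooth_on_subset[OF smooth Wsub] sF]) (use uI Wsub in auto)
    ultimately have "smooth_on ?W (\<lambda>y. (chart M j (param M i y), F (\<pi> (param M i y))))"
      unfolding smooth_on_def by (auto intro!: Ck_on_Pair[OF W])
    moreover have "{x \<in> cdom M i. (x, F (\<pi> x)) \<in> cdom ?P k} = cdom M i \<inter> cdom M j"
      by (auto simp: j times_line_simps)
    ultimately show "smooth_on (chart M i ` {x \<in> cdom M i. (x, F (\<pi> x)) \<in> cdom ?P k})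
        (local_rep M ?P (\<lambda>x. (x, F (\<pi> x))) i k)"
      by (simp add: local_rep_def comp_def j times_line_simps)
  qed
  have trans: "translating_soliton M g \<epsilon>' ?S"
    unfolding translating_soliton_def Let_def nondegenerate_hypersurface_def hypersurface_def
  proof (intro conjI ballI)
    show "?S \<subseteq> pts ?P" by (auto simp: graph_on_def times_line_simps)
  next
    fix p assume "p \<in> ?S"
    then obtain x where x: "x \<in> pts M" "p = (x, F (\<pi> x))" by (auto simp: graph_on_def)
    obtain i where ix: "i \<in> idx M" "x \<in> cdom M i" using inP[OF x(1)] by blast
    interpret soliton_graph_chart M g \<pi> i \<epsilon> F "deriv F" w' I \<epsilon>' by (rule chart[OF ix(1)])
    interpret L: level_hypersurface_point ?P "prod_metric g (line_metric \<epsilon>')" ?S "(i, ())" \<rho> "(x, F (\<pi> x))" "N x"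
      by (rule graph_point[OF ix(2)])
    show "\<exists>k\<in>charts_at ?P p. \<exists>V \<rho>. open V \<and> chart ?P k p \<in> V \<and> V \<subseteq> crange ?P k \<and> smooth_on V \<rho> \<and>
        (\<forall>y\<in>V. frechet_derivative \<rho> (at y) \<noteq> (\<lambda>_. 0)) \<and>
        (\<forall>q\<in>cdom ?P k. chart ?P k q \<in> V \<longrightarrow> (q \<in> ?S \<longleftrightarrow> \<rho> (chart ?P k q) = (0::real)))"
    proof (intro bexI[of _ "(i, ())"] exI[of _ "crange ?P (i, ())"] exI[of _ \<rho>] conjI ballI impI)
      show "(i, ()) \<in> charts_at ?P p" using ix x by (simp add: charts_at_def times_line_simps)
      show "chart ?P (i, ()) p \<in> crange ?P (i, ())" using L.chart_p_in x by simp
      show "frechet_derivative \<rho> (at y) \<noteq> (\<lambda>_. 0)" if "y \<in> crange ?P (i, ())" for y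
        using L.regular[OF that] by auto
    qed (use L.op L.smooth L.zero in auto)
  next
    fix p k assume "p \<in> ?S" and k: "k \<in> charts_at ?P p"
    then obtain x where x: "x \<in> pts M" "p = (x, F (\<pi> x))" by (auto simp: graph_on_def)
    obtain i where ix: "k = (i, ())" "i \<in> idx M" "x \<in> cdom M i"
      using k x by (auto simp: charts_at_def times_line_simps)
    interpret soliton_graph_chart M g \<pi> i \<epsilon> F "deriv F" w' I \<epsilon>' by (rule chart[OF ix(2)])
    interpret L: level_hypersurface_point ?P "prod_metric g (line_metric \<epsilon>')" ?S "(i, ())" \<rho> "(x, F (\<pi> x))" "N x"
      by (rule graph_point[OF ix(3)])
    have "\<pi> x \<in> I" using x im by blast
    then show "mean_curvature_vector ?P (prod_metric g (line_metric \<epsilon>')) ?S k p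
        = normal_part (prod_metric g (line_metric \<epsilon>') k (chart ?P k p)) (tangent_space ?P ?S k p) (0, 1)"
      unfolding ix x by (intro graph_soliton_equation[OF ix(3) _ mc]) (simp_all add: w'_def)
    show "nondegenerate_on (prod_metric g (line_metric \<epsilon>') k (chart ?P k p)) (tangent_space ?P ?S k p)"
      using L.T_nondegenerate by (simp add: ix x)
  qed
  have inv: "invariant_under G \<phi> ?S"
    unfolding invariant_under_def
  proof
    fix \<sigma> assume \<sigma>: "\<sigma> \<in> carrier G"
    interpret group_action G "pts M" \<phi> using act by (simp add: proper_isometric_action_def)
    \<comment> \<open>The fibres of \<pi> are the orbits, so \<pi> is invariant; as \<sigma>
      permutes M, the graph is mapped onto itself.\<close>
    have "\<pi> (\<phi> \<sigma> x) = \<pi> x" if "x \<in> pts M" for x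
      using fib[OF that] \<sigma> by (auto simp: orbit_def)
    then have "(\<lambda>(x, t). (\<phi> \<sigma> x, t)) ` ?S = (\<lambda>x. (x, F (\<pi> x))) ` (\<phi> \<sigma> ` pts M)"
      by (force simp: graph_on_def image_iff)
    then show "(\<lambda>(x, t). (\<phi> \<sigma> x, t)) ` ?S = ?S"
      by (simp add: surj_prop[OF \<sigma>] graph_on_def comp_def)
  qed
  have "graph_on {x \<in> pts M. \<pi> x \<in> J} (f \<circ> \<pi>) \<subseteq> ?S"
    using FJ by (auto simp: graph_on_def image_iff)
  then show ?thesis using sol FJ F_map trans inv by blast
qed

end
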